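(* Let $i \in \{0,1\}$ and $n \geq 1$, and let $\Gamma$ be $\Pi^i_n$, $\Sigma^i_n$, or $\Delta^1_n$. Then $\Gamma$-$\mathsf{CE}$ is provable in $\Gamma$-$\mathsf{CA}_0$.
   Context: We work in subsystems of second-order arithmetic ($\mathsf{L}_2$). A formula $\varphi(X)$ with one free set variable (possibly with set parameters) is of finite character if $\varphi(\emptyset)$ holds and, for every set $A$, $\varphi(A)$ holds iff $\varphi(F)$ holds for every finite $F \subseteq A$. A finitary closure operator is a set $D$ of pairs $\langle F, n\rangle$ where $F$ is (the canonical index of) a finite, possibly empty, subset of $\mathbb{N}$ and $n \in \mathbb{N}$; a set $A \subseteq \mathbb{N}$ is $D$-closed if for every $\langle F,n\rangle \in D$ with $F \subseteq A$ we have $n \in A$. $\mathsf{CE}$ is the scheme: if $D$ is a finitary closure operator, $\varphi$ is an $\mathsf{L}_2$ formula of finite character, and $A$ is any set, then every $D$-closed subset of $A$ satisfying $\varphi$ is contained in a maximal (under $\subseteq$) $D$-closed subset of $A$ satisfying $\varphi$. For $\Gamma = \Sigma^i_n$ or $\Pi^i_n$, $\Gamma$-$\mathsf{CE}$ is the restriction of $\mathsf{CE}$ to formulas $\varphi$ in $\Gamma$; $\Delta^1_n$-$\mathsf{CE}$ is the restriction to $\Sigma^1_n$ formulas $\varphi$ of finite character for which there is a $\Pi^1_n$ formula $\psi$ with $(\forall X)[\varphi(X)\Longleftrightarrow\psi(X)]$. $\Gamma$-$\mathsf{CA}_0$ is $\mathsf{RCA}_0$ plus comprehension for formulas in $\Gamma$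 (for $\Delta^1_n$: comprehension for $\Sigma^1_n$ formulas equivalent to $\Pi^1_n$ formulas). *)

theory Defs
  imports Main
begin

text \<open>
  The two-sorted language of second-order arithmetic, in de Bruijn form.  Number variables and
  set variables are indexed separately: \<open>AllN\<close> binds number variable 0 and leaves set indices
  alone, \<open>AllS\<close> binds set variable 0 and leaves number indices alone.  As usual there is
  no primitive equality between sets.
\<close>

datatype tm = Var nat | Zero | One | Add tm tm | Mul tm tm

datatype fm =
    Eq tm tm
  | Less tm tm
  | Mem tm nat
  | Fls
  | Imp fm fm
  | AllN fm
  | AllS fm

abbreviation Neg :: "fm \<Rightarrow> fm" where "Neg p \<equiv> Imp p Fls"
abbreviation And :: "fm \<Rightarrow> fm \<Rightarrow> fm" where "And p q \<equiv> Neg (Imp p (Neg q))"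
abbreviation Or :: "fm \<Rightarrow> fm \<Rightarrow> fm" where "Or p q \<equiv> Imp (Neg p) q"
abbreviation Iff :: "fm \<Rightarrow> fm \<Rightarrow> fm" where "Iff p q \<equiv> And (Imp p q) (Imp q p)"
abbreviation ExN :: "fm \<Rightarrow> fm" where "ExN p \<equiv> Neg (AllN (Neg p))"
abbreviation ExS :: "fm \<Rightarrow> fm" where "ExS p \<equiv> Neg (AllS (Neg p))"


section \<open>Substitution and universal closure\<close>

primrec tsub :: "(nat \<Rightarrow> tm) \<Rightarrow> tm \<Rightarrow> tm" where
  "tsub s (Var i) = s i"
| "tsub s Zero = Zero"
| "tsub s One = One"
| "tsub s (Add t u) = Add (tsub s t) (tsub s u)"
| "tsub s (Mul t u) = Mul (tsub s t) (tsub s u)"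

definition lift :: "nat \<Rightarrow> tm \<Rightarrow> tm" where
  "lift k t = tsub (\<lambda>i. Var (i + k)) t"

text \<open>Simultaneous capture-avoiding substitution of terms (\<open>s\<close>) for number variables and of
  set variables (\<open>r\<close>) for set variables.\<close>

primrec fsub :: "(nat \<Rightarrow> tm) \<Rightarrow> (nat \<Rightarrow> nat) \<Rightarrow> fm \<Rightarrow> fm" where
  "fsub s r (Eq t u) = Eq (tsub s t) (tsub s u)"
| "fsub s r (Less t u) = Less (tsub s t) (tsub s u)"
| "fsub s r (Mem t X) = Mem (tsub s t) (r X)"
| "fsub s r Fls = Fls"
| "fsub s r (Imp p q) = Imp (fsub s r p) (fsub s r q)"
| "fsub s r (AllN p) = AllN (fsub (case_nat (Var 0) (\<lambda>i. lift 1 (s i))) r p)"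
| "fsub s r (AllS p) = AllS (fsub s (case_nat 0 (\<lambda>i. Suc (r i))) p)"

definition shiftN :: "fm \<Rightarrow> fm" where "shiftN p = fsub (\<lambda>i. Var (Suc i)) id p"
definition shiftS :: "fm \<Rightarrow> fm" where "shiftS p = fsub Var Suc p"

definition instN :: "tm \<Rightarrow> fm \<Rightarrow> fm" where "instN t p = fsub (case_nat t Var) id p"
definition instS :: "nat \<Rightarrow> fm \<Rightarrow> fm" where "instS Y p = fsub Var (case_nat Y id) p"

text \<open>\<open>nlev\<close> and \<open>slev\<close> are the least strict upper bounds of the free number (set) indices.\<close>

primrec tlev :: "tm \<Rightarrow> nat" where
  "tlev (Var i) = Suc i"
| "tlev Zero = 0"
| "tlev One = 0"
| "tlev (Add t u) = max (tlev t) (tlev u)"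
| "tlev (Mul t u) = max (tlev t) (tlev u)"

primrec nlev :: "fm \<Rightarrow> nat" where
  "nlev (Eq t u) = max (tlev t) (tlev u)"
| "nlev (Less t u) = max (tlev t) (tlev u)"
| "nlev (Mem t X) = tlev t"
| "nlev Fls = 0"
| "nlev (Imp p q) = max (nlev p) (nlev q)"
| "nlev (AllN p) = nlev p - 1"
| "nlev (AllS p) = nlev p"

primrec slev :: "fm \<Rightarrow> nat" where
  "slev (Eq t u) = 0"
| "slev (Less t u) = 0"
| "slev (Mem t X) = Suc X"
| "slev Fls = 0"
| "slev (Imp p q) = max (slev p) (slev q)"
| "slev (AllN p) = slev p"
| "slev (AllS p) = slev p - 1"

definition ucl :: "fm \<Rightarrow> fm" where
  "ucl p = (AllN ^^ nlev p) ((AllS ^^ slev p) p)"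


section \<open>Classical two-sorted natural deduction\<close>

inductive deriv :: "fm set \<Rightarrow> fm \<Rightarrow> bool" (infix "\<turnstile>" 50) where
  Assm: "p \<in> T \<Longrightarrow> T \<turnstile> p"
| ImpI: "insert p T \<turnstile> q \<Longrightarrow> T \<turnstile> Imp p q"
| ImpE: "T \<turnstile> Imp p q \<Longrightarrow> T \<turnstile> p \<Longrightarrow> T \<turnstile> q"
| Contr: "insert (Neg p) T \<turnstile> Fls \<Longrightarrow> T \<turnstile> p"
| AllNI: "shiftN ` T \<turnstile> p \<Longrightarrow> T \<turnstile> AllN p"
| AllNE: "T \<turnstile> AllN p \<Longrightarrow> T \<turnstile> instN t p"
| AllSI: "shiftS ` T \<turnstile> p \<Longrightarrow> T \<turnstile> AllS p"
| AllSE: "T \<turnstile> AllS p \<Longrightarrow> T \<turnstile> instS Y p"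
| EqRefl: "T \<turnstile> Eq t t"
| EqSubst: "T \<turnstile> Eq t u \<Longrightarrow> T \<turnstile> instN t p \<Longrightarrow> T \<turnstile> instN u p"


section \<open>Formula classes\<close>

text \<open>Bounded-quantifier formulas; the bound \<open>t\<close> does not contain the quantified variable.
  Set parameters are allowed here and in arithmetical formulas.\<close>

inductive bounded_fm :: "fm \<Rightarrow> bool" where
  "bounded_fm (Eq t u)"
| "bounded_fm (Less t u)"
| "bounded_fm (Mem t X)"
| "bounded_fm Fls"
| "bounded_fm p \<Longrightarrow> bounded_fm q \<Longrightarrow> bounded_fm (Imp p q)"
| "bounded_fm p \<Longrightarrow> bounded_fm (AllN (Imp (Less (Var 0) (lift 1 t)) p))"
| "bounded_fm p \<Longrightarrow> bounded_fm (ExN (And (Less (Var 0) (lift 1 t)) p))"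

primrec arithmetical :: "fm \<Rightarrow> bool" where
  "arithmetical (Eq t u) = True"
| "arithmetical (Less t u) = True"
| "arithmetical (Mem t X) = True"
| "arithmetical Fls = True"
| "arithmetical (Imp p q) = (arithmetical p \<and> arithmetical q)"
| "arithmetical (AllN p) = arithmetical p"
| "arithmetical (AllS p) = False"

text \<open>\<open>Sigma_fm i n\<close> and \<open>Pi_fm i n\<close> are \<open>\<Sigma>\<^sup>i\<^sub>n\<close> and \<open>\<Pi>\<^sup>i\<^sub>n\<close>, for \<open>i = 0\<close> and \<open>i = 1\<close>:
  \<open>n\<close> alternating single number (set) quantifiers before a bounded-quantifier (arithmetical)
  matrix.\<close>

fun Sigma_fm Pi_fm :: "nat \<Rightarrow> nat \<Rightarrow> fm set" where
  "Sigma_fm i 0 = (if i = 0 then {p. bounded_fm p} else {p. arithmetical p})"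
| "Pi_fm i 0 = (if i = 0 then {p. bounded_fm p} else {p. arithmetical p})"
| "Sigma_fm i (Suc n) = (if i = 0 then {ExN p | p. p \<in> Pi_fm i n} else {ExS p | p. p \<in> Pi_fm i n})"
| "Pi_fm i (Suc n) = (if i = 0 then {AllN p | p. p \<in> Sigma_fm i n} else {AllS p | p. p \<in> Sigma_fm i n})"

text \<open>Names of the classes \<open>\<Sigma>\<^sup>i\<^sub>n\<close>, \<open>\<Pi>\<^sup>i\<^sub>n\<close> and \<open>\<Delta>\<^sup>1\<^sub>n\<close>; the last is not a set of formulas.\<close>

datatype fclass = SigmaC nat nat | PiC nat nat | Delta1C nat


section \<open>The theories\<close>

definition basic_axioms :: "fm set" where
  "basic_axioms = (let m = Var 1; n = Var 0 in
    { Neg (Eq (Add n One) Zero),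
      Imp (Eq (Add m One) (Add n One)) (Eq m n),
      Eq (Add n Zero) n,
      Eq (Add m (Add n One)) (Add (Add m n) One),
      Eq (Mul n Zero) Zero,
      Eq (Mul m (Add n One)) (Add (Mul m n) m),
      Neg (Less n Zero),
      Iff (Less m (Add n One)) (Or (Less m n) (Eq m n)) })"

text \<open>In the schemes below number variable 0 of \<open>p\<close> is the distinguished one; all other free
  variables are parameters.\<close>

definition induction_ax :: "fm \<Rightarrow> fm" where
  "induction_ax p =
    Imp (And (instN Zero p)
             (AllN (Imp p (fsub (case_nat (Add (Var 0) One) (\<lambda>i. Var (Suc i))) id p))))
        (AllN p)"

definition comprehension_ax :: "fm \<Rightarrow> fm" where
  "comprehension_ax p = ExS (AllN (Iff (Mem (Var 0) 0) (shiftS p)))"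

definition delta_comprehension_ax :: "fm \<Rightarrow> fm \<Rightarrow> fm" where
  "delta_comprehension_ax p q = Imp (AllN (Iff p q)) (comprehension_ax p)"

definition RCA0 :: "fm set" where
  "RCA0 = ucl ` (basic_axioms
    \<union> {induction_ax p | p. p \<in> Sigma_fm 0 1}
    \<union> {delta_comprehension_ax p q | p q. p \<in> Sigma_fm 0 1 \<and> q \<in> Pi_fm 0 1})"

fun CA :: "fclass \<Rightarrow> fm set" where
  "CA (SigmaC i n) = {ucl (comprehension_ax p) | p. p \<in> Sigma_fm i n}"
| "CA (PiC i n) = {ucl (comprehension_ax p) | p. p \<in> Pi_fm i n}"
| "CA (Delta1C n) = {ucl (delta_comprehension_ax p q) | p q. p \<in> Sigma_fm 1 n \<and> q \<in> Pi_fm 1 n}"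

definition CA0 :: "fclass \<Rightarrow> fm set" where
  "CA0 C = RCA0 \<union> CA C"


section \<open>Finite sets and closure operators in second-order arithmetic\<close>

text \<open>Coding as in Simpson, \<^emph>\<open>Subsystems of Second Order Arithmetic\<close>, II.2: the pair \<open>(i, j)\<close>
  is \<open>(i + j)\<^sup>2 + i\<close>, and \<open>(k, (m, n))\<close> codes the finite set of all \<open>x < k\<close> such that
  \<open>m (x + 1) + 1\<close> divides \<open>n\<close>.  The canonical index of a finite set is its least code.\<close>

definition pair_tm :: "tm \<Rightarrow> tm \<Rightarrow> tm" where
  "pair_tm t u = Add (Mul (Add t u) (Add t u)) t"

definition dvd_fm :: "tm \<Rightarrow> tm \<Rightarrow> fm" where
  "dvd_fm t u = ExN (Eq (lift 1 u) (Mul (lift 1 t) (Var 0)))"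

definition code_fm :: "tm \<Rightarrow> fm" where
  "code_fm e = ExN (ExN (ExN (Eq (lift 3 e) (pair_tm (Var 2) (pair_tm (Var 1) (Var 0))))))"

definition in_code_fm :: "tm \<Rightarrow> tm \<Rightarrow> fm" where
  "in_code_fm t e =
    ExN (ExN (ExN (And (Eq (lift 3 e) (pair_tm (Var 2) (pair_tm (Var 1) (Var 0))))
      (And (Less (lift 3 t) (Var 2))
           (dvd_fm (Add (Mul (Var 1) (Add (lift 3 t) One)) One) (Var 0))))))"

definition canonical_fm :: "tm \<Rightarrow> fm" where
  "canonical_fm e = And (code_fm e)
    (Neg (ExN (And (Less (Var 0) (lift 1 e))
      (And (code_fm (Var 0))
           (AllN (Iff (in_code_fm (Var 0) (Var 1)) (in_code_fm (Var 0) (lift 2 e))))))))"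

definition subset_fm :: "nat \<Rightarrow> nat \<Rightarrow> fm" where
  "subset_fm X Y = AllN (Imp (Mem (Var 0) X) (Mem (Var 0) Y))"

definition empty_fm :: "nat \<Rightarrow> fm" where
  "empty_fm X = AllN (Neg (Mem (Var 0) X))"

definition finite_fm :: "nat \<Rightarrow> fm" where
  "finite_fm X = ExN (AllN (Imp (Mem (Var 0) X) (Less (Var 0) (Var 1))))"

definition closure_op_fm :: "nat \<Rightarrow> fm" where
  "closure_op_fm D = AllN (Imp (Mem (Var 0) D)
    (ExN (ExN (And (Eq (Var 2) (pair_tm (Var 1) (Var 0))) (canonical_fm (Var 1))))))"

definition closed_fm :: "nat \<Rightarrow> nat \<Rightarrow> fm" where
  "closed_fm D A = AllN (AllN
    (Imp (And (Mem (pair_tm (Var 1) (Var 0)) D)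
              (AllN (Imp (in_code_fm (Var 0) (Var 2)) (Mem (Var 0) A))))
         (Mem (Var 0) A)))"


section \<open>The closure extension scheme\<close>

text \<open>The formula \<open>p\<close> is read as \<open>\<phi>(X)\<close> with \<open>X\<close> its set variable 0.  Inside \<open>k\<close> set quantifiers,
  \<open>set_inst k Y p\<close> is \<open>\<phi>(Y)\<close>: set parameter \<open>Suc i\<close> of \<open>p\<close> becomes index \<open>i + k\<close>.\<close>

definition set_inst :: "nat \<Rightarrow> nat \<Rightarrow> fm \<Rightarrow> fm" where
  "set_inst k Y p = fsub Var (case_nat Y (\<lambda>i. i + k)) p"

definition finite_character_fm :: "fm \<Rightarrow> fm" where
  "finite_character_fm p =
    And (AllS (Imp (empty_fm 0) (set_inst 1 0 p)))
        (AllS (Iff (set_inst 1 0 p)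
                   (AllS (Imp (And (finite_fm 0) (subset_fm 0 1)) (set_inst 2 0 p)))))"

text \<open>\<open>good_fm k D A X p\<close>: \<open>X\<close> is a \<open>D\<close>-closed subset of \<open>A\<close> satisfying \<open>p\<close>.\<close>

definition good_fm :: "nat \<Rightarrow> nat \<Rightarrow> nat \<Rightarrow> nat \<Rightarrow> fm \<Rightarrow> fm" where
  "good_fm k D A X p = And (closed_fm D X) (And (subset_fm X A) (set_inst k X p))"

text \<open>The quantified sets are, from the outside in, \<open>D\<close>, \<open>A\<close>, the given set \<open>B\<close>, the maximal
  extension \<open>M\<close> and a competitor \<open>N\<close>.\<close>

definition closure_extension_fm :: "fm \<Rightarrow> fm" where
  "closure_extension_fm p =
    Imp (finite_character_fm p)
      (AllS (AllS (Imp (closure_op_fm 1)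
        (AllS (Imp (good_fm 3 2 1 0 p)
          (ExS (And (And (subset_fm 1 0) (good_fm 4 3 2 0 p))
            (AllS (Imp (And (good_fm 5 4 3 0 p) (subset_fm 1 0)) (subset_fm 0 1))))))))))"

fun CE :: "fclass \<Rightarrow> fm set" where
  "CE (SigmaC i n) = {ucl (closure_extension_fm p) | p. p \<in> Sigma_fm i n}"
| "CE (PiC i n) = {ucl (closure_extension_fm p) | p. p \<in> Pi_fm i n}"
| "CE (Delta1C n) = {ucl (Imp (AllS (Iff p q)) (closure_extension_fm p)) | p q.
      p \<in> Sigma_fm 1 n \<and> q \<in> Pi_fm 1 n}"

end

theory Submission
  imports Defs "HOL-Library.Countable_Set"
begin

text \<open>
  By completeness it suffices to extend a closed set in an arbitrary, possibly nonstandard, model.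
  In each of the theories, sets are closed under arithmetical definability, and for a formula \<open>\<phi>\<close> of
  the class the set \<open>W\<close> of codes of finite sets satisfying \<open>\<phi>\<close> exists: replacing \<open>t \<in> X\<close> by
  membership in a coded finite set keeps the set quantifier prefix of \<open>\<phi>\<close>.  By finite character,
  \<open>\<phi>\<close> holds of a set iff all codes of its finite subsets lie in \<open>W\<close>, which is arithmetical.  The
  closure of \<open>B \<union> X\<close> is arithmetical in \<open>X\<close>, and ``the closure of \<open>B \<union> X\<close> is contained in \<open>A\<close>
  and satisfies \<open>\<phi>\<close>'' is again a property of \<open>X\<close> of finite character.  Adding numbers
  greedily while preserving it yields a set \<open>G\<close>, and the closure of \<open>B \<union> G\<close> is maximal.
\<close>

text \<open>Greedy choice cannot act on closed sets directly, since adding one number to a closed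
  set seldom leaves it closed. It acts on generators, and the test \<open>\<Psi>\<close> looks at
  the closure they generate. The closure is defined by coded derivations: an intersection of all
  closed supersets would quantify over sets and leave the arithmetical level. Because a model may be
  nonstandard, a finite object means a coded bounded set, and no outer recursion or induction is
  available: merging derivations, running the greedy choice and proving it correct all happen by
  induction inside the model, for predicates shown definable. The predicate \<open>dpred\<close>
  does this bookkeeping. What the theories share is comprehension for one universal number
  quantifier before a bounded matrix; feeding the resulting sets back as parameters gives every
  arithmetical predicate. Beyond this only the set \<open>W\<close> is asked for, and only there
  does the class of \<phi> matter. For i = 0 it exists because \<phi> is arithmetical, so the number
  quantifiers that \<open>in_code_fm\<close> adds do no harm.\<close>

section \<open>Substitution\<close>

lemma tsub_tsub: "tsub s (tsub s' t) = tsub (\<lambda>i. tsub s (s' i)) t"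
  by (induction t) auto

lemma tsub_Var [simp]: "tsub Var t = t"
  by (induction t) auto

lemma tsub_lift: "tsub s (lift k t) = tsub (\<lambda>i. s (i + k)) t"
  by (simp add: lift_def tsub_tsub)

text \<open>Besides serving the composition law, this keeps the bound of a bounded quantifier in the
  form \<open>lift 1 t\<close>, so bounded formulas are stable under substitution.\<close>

lemma tsub_up_lift:
  "tsub (case_nat (Var 0) (\<lambda>i. lift 1 (s i))) (lift 1 t) = lift 1 (tsub s t)"
  by (simp add: tsub_lift lift_def tsub_tsub)

text \<open>Later identities between substitutions reduce to this composition law and a comparison
  of two functions on variables.\<close>

lemma fsub_fsub:
  "fsub s r (fsub s' r' p) = fsub (\<lambda>i. tsub s (s' i)) (\<lambda>i. r (r' i)) p"
proof (induction p arbitrary: s r s' r')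
  case (AllN p)
  have "(\<lambda>i. tsub (case_nat (Var 0) (\<lambda>i. lift 1 (s i)))
          (case_nat (Var 0) (\<lambda>i. lift 1 (s' i)) i)) =
        case_nat (Var 0) (\<lambda>i. lift 1 (tsub s (s' i)))"
    by (rule ext) (simp add: tsub_up_lift del: One_nat_def split: nat.split)
  then show ?case by (simp add: AllN del: One_nat_def)
next
  case (AllS p)
  have "(\<lambda>i. case_nat 0 (\<lambda>i. Suc (r i)) (case_nat 0 (\<lambda>i. Suc (r' i)) i)) =
        case_nat 0 (\<lambda>i. Suc (r (r' i)))"
    by (rule ext) (simp split: nat.split)
  then show ?case by (simp add: AllS)
qed (simp_all add: tsub_tsub)

lemma tsub_cong: "(\<And>i. i < tlev t \<Longrightarrow> s i = s' i) \<Longrightarrow> tsub s t = tsub s' t"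
  by (induction t) auto

lemma fsub_cong:
  "\<lbrakk>\<And>i. i < nlev p \<Longrightarrow> s i = s' i; \<And>i. i < slev p \<Longrightarrow> r i = r' i\<rbrakk> \<Longrightarrow> fsub s r p = fsub s' r' p"
proof (induction p arbitrary: s r s' r')
  case (Eq t u)
  then show ?case using tsub_cong[of t s s'] tsub_cong[of u s s'] by auto
next
  case (Less t u)
  then show ?case using tsub_cong[of t s s'] tsub_cong[of u s s'] by auto
next
  case (Mem t X)
  then show ?case using tsub_cong[of t s s'] by auto
next
  case Fls
  then show ?case by simp
next
  case (Imp p q)
  have "fsub s r p = fsub s' r' p" "fsub s r q = fsub s' r' q"
    by (rule Imp.IH; simp add: Imp.prems)+
  then show ?case by simp
next
  case (AllN p)
  have "fsub (case_nat (Var 0) (\<lambda>i. lift 1 (s i))) r p =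
    fsub (case_nat (Var 0) (\<lambda>i. lift 1 (s' i))) r' p"
    by (rule AllN.IH) (use AllN.prems in \<open>simp_all split: nat.split\<close>)
  then show ?case by simp
next
  case (AllS p)
  have "fsub s (case_nat 0 (\<lambda>i. Suc (r i))) p = fsub s' (case_nat 0 (\<lambda>i. Suc (r' i))) p"
    by (rule AllS.IH) (use AllS.prems in \<open>simp_all split: nat.split\<close>)
  then show ?case by simp
qed

lemma up_Var: "case_nat (Var 0) (\<lambda>i. lift 1 (Var i)) = Var"
  by (rule ext) (simp add: lift_def split: nat.split)

lemma up_id: "case_nat 0 Suc = id"
  by (rule ext) (simp split: nat.split)

lemma fsub_id' [simp]: "fsub Var (\<lambda>i. i) p = p"
proof (induction p)
  case (AllN p)
  then show ?case by (simp only: fsub.simps up_Var)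
next
  case (AllS p)
  then show ?case using up_id by (simp add: id_def)
qed auto

lemma fsub_id [simp]: "fsub Var id p = p"
  using fsub_id' by (simp only: id_def)

lemma fsub_shiftN:
  "fsub (case_nat (Var 0) (\<lambda>i. lift 1 (s i))) r (shiftN p) = shiftN (fsub s r p)"
  by (simp add: shiftN_def fsub_fsub lift_def)

lemma fsub_shiftS: "fsub s (case_nat 0 (\<lambda>i. Suc (r i))) (shiftS p) = shiftS (fsub s r p)"
  by (simp add: shiftS_def fsub_fsub)

text \<open>The form in which the quantifier case of the truth lemma for the term model meets an
  instance.\<close>

lemma instN_fsub: "instN t (fsub (case_nat (Var 0) (\<lambda>i. lift 1 (s i))) r p) = fsub (case_nat t s) r p"
proof -
  have "(\<lambda>i. tsub (case_nat t Var) (case_nat (Var 0) (\<lambda>i. lift 1 (s i)) i)) = case_nat t s"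
    by (rule ext) (simp add: tsub_lift split: nat.split)
  then show ?thesis by (simp add: instN_def fsub_fsub del: One_nat_def)
qed

lemma instS_fsub: "instS Y (fsub s (case_nat 0 (\<lambda>i. Suc (r i))) p) = fsub s (case_nat Y r) p"
proof -
  have "(\<lambda>i. case_nat Y id (case_nat 0 (\<lambda>i. Suc (r i)) i)) = case_nat Y r"
    by (rule ext) (simp split: nat.split)
  then show ?thesis by (simp add: instS_def fsub_fsub)
qed

lemma fsub_instN:
  "fsub s r (instN t p) = instN (tsub s t) (fsub (case_nat (Var 0) (\<lambda>i. lift 1 (s i))) r p)"
proof -
  have "(\<lambda>i. tsub s (case_nat t Var i)) = case_nat (tsub s t) s"
    by (rule ext) (simp split: nat.split)
  then show ?thesis unfolding instN_fsub by (simp add: instN_def fsub_fsub)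
qed

lemma fsub_instS:
  "fsub s r (instS Y p) = instS (r Y) (fsub s (case_nat 0 (\<lambda>i. Suc (r i))) p)"
proof -
  have "(\<lambda>i. r (case_nat Y id i)) = case_nat (r Y) r"
    by (rule ext) (simp split: nat.split)
  then show ?thesis unfolding instS_fsub by (simp add: instS_def fsub_fsub)
qed


section \<open>Completeness of the calculus\<close>

lemma deriv_mono: "T \<turnstile> p \<Longrightarrow> T \<subseteq> T' \<Longrightarrow> T' \<turnstile> p"
proof (induction arbitrary: T' rule: deriv.induct)
  case (Assm p T)
  then show ?case by (auto intro: deriv.Assm)
next
  case (ImpI p T q)
  then show ?case by (auto intro!: deriv.ImpI)
next
  case (ImpE T p q)
  then show ?case by (blast intro: deriv.ImpE)
next
  case (Contr p T)
  have "insert (Neg p) T' \<turnstile> Fls" by (rule Contr.IH) (use Contr.prems in auto)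
  then show ?case by (rule deriv.Contr)
next
  case (AllNI T p)
  then show ?case by (auto intro!: deriv.AllNI)
next
  case (AllSI T p)
  then show ?case by (auto intro!: deriv.AllSI)
next
  case (EqSubst T t u p)
  then show ?case by (blast intro: deriv.EqSubst)
qed (auto intro: deriv.intros)

text \<open>Makes the union of a chain of consistent sets consistent. In the eigenvariable rules a
  finite set of shifted formulas has to be pulled back to a finite set of premises.\<close>

lemma deriv_finite: "T \<turnstile> p \<Longrightarrow> \<exists>F. finite F \<and> F \<subseteq> T \<and> F \<turnstile> p"
proof (induction rule: deriv.induct)
  case (Assm p T)
  then show ?case by (intro exI[of _ "{p}"]) (auto intro: deriv.Assm)
next
  case (ImpI p T q)
  then obtain F where F: "finite F" "F \<subseteq> insert p T" "F \<turnstile> q" by blast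
  then have "insert p (F - {p}) \<turnstile> q" by (elim deriv_mono) blast
  then have "F - {p} \<turnstile> Imp p q" by (rule deriv.ImpI)
  then show ?case using F by (metis Diff_subset_conv finite_Diff insert_is_Un)
next
  case (ImpE T p q)
  then obtain F F' where "finite F" "F \<subseteq> T" "F \<turnstile> Imp p q" "finite F'" "F' \<subseteq> T" "F' \<turnstile> p" by blast
  then show ?case
    by (meson deriv.ImpE deriv_mono finite_UnI sup.bounded_iff sup_ge1 sup_ge2)
next
  case (Contr p T)
  then obtain F where F: "finite F" "F \<subseteq> insert (Neg p) T" "F \<turnstile> Fls" by blast
  then have "insert (Neg p) (F - {Neg p}) \<turnstile> Fls" by (elim deriv_mono) blast
  then have "F - {Neg p} \<turnstile> p" by (rule deriv.Contr)
  then show ?case using F by (metis Diff_subset_conv finite_Diff insert_is_Un)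
next
  case (AllNI T p)
  then obtain F where "finite F" "F \<subseteq> shiftN ` T" "F \<turnstile> p" by blast
  moreover from this obtain F' where "finite F'" "F' \<subseteq> T" "F = shiftN ` F'"
    by (meson finite_subset_image)
  ultimately show ?case by (auto intro: deriv.AllNI)
next
  case (AllSI T p)
  then obtain F where "finite F" "F \<subseteq> shiftS ` T" "F \<turnstile> p" by blast
  moreover from this obtain F' where "finite F'" "F' \<subseteq> T" "F = shiftS ` F'"
    by (meson finite_subset_image)
  ultimately show ?case by (auto intro: deriv.AllSI)
next
  case (EqRefl T t)
  then show ?case by (auto intro: deriv.EqRefl)
next
  case (EqSubst T t u p)
  then obtain F F' where "finite F" "F \<subseteq> T" "F \<turnstile> Eq t u" "finite F'" "F' \<subseteq> T" "F' \<turnstile> instN t p" by blast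
  then show ?case
    by (meson deriv.EqSubst deriv_mono finite_UnI sup.bounded_iff sup_ge1 sup_ge2)
qed (blast intro: deriv.intros)+

lemma deriv_fsub: "T \<turnstile> p \<Longrightarrow> fsub s r ` T \<turnstile> fsub s r p"
proof (induction arbitrary: s r rule: deriv.induct)
  case (Assm p T)
  then show ?case by (auto intro: deriv.Assm)
next
  case (ImpI p T q)
  then show ?case by (auto intro: deriv.ImpI)
next
  case (ImpE T p q)
  then show ?case by (metis deriv.ImpE fsub.simps(5))
next
  case (Contr p T)
  then show ?case by (auto intro: deriv.Contr)
next
  case (AllNI T p)
  then show ?case
    using AllNI.IH[of "case_nat (Var 0) (\<lambda>i. lift 1 (s i))" r]
    by (auto intro!: deriv.AllNI simp: image_image fsub_shiftN simp del: One_nat_def)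
next
  case (AllNE T p t)
  then show ?case unfolding fsub_instN using deriv.AllNE by fastforce
next
  case (AllSI T p)
  then show ?case
    using AllSI.IH[of s "case_nat 0 (\<lambda>i. Suc (r i))"]
    by (auto intro!: deriv.AllSI simp: image_image fsub_shiftS)
next
  case (AllSE T p t)
  then show ?case unfolding fsub_instS using deriv.AllSE by fastforce
next
  case (EqRefl T t)
  then show ?case by (auto intro: deriv.EqRefl)
next
  case (EqSubst T t u p)
  then show ?case unfolding fsub_instN using deriv.EqSubst by fastforce
qed

text \<open>The renaming \<open>?s\<close> moves index c to 0 and every other index up by one. On
  \<open>G\<close>, where c is not free, this is \<open>shiftN\<close>; on the instance of
  \<open>q\<close> at c it undoes the instantiation.\<close>

lemma AllN_fresh:
  assumes "G \<turnstile> instN (Var c) q" "\<And>g. g \<in> G \<Longrightarrow> nlev g \<le> c" "nlev q \<le> Suc c"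
  shows "G \<turnstile> AllN q"
proof (rule AllNI)
  let ?s = "\<lambda>i. if i = c then Var 0 else Var (Suc i)"
  have "fsub ?s id ` G \<turnstile> fsub ?s id (instN (Var c) q)"
    using assms(1) by (rule deriv_fsub)
  moreover have "fsub ?s id ` G = shiftN ` G"
    unfolding shiftN_def by (intro image_cong refl fsub_cong) (use assms(2) in force)+
  moreover have "fsub ?s id (instN (Var c) q) = q"
  proof -
    have "fsub ?s id (instN (Var c) q) = fsub (\<lambda>i. tsub ?s (case_nat (Var c) Var i)) id q"
      by (simp add: instN_def fsub_fsub id_def)
    also have "\<dots> = fsub Var id q"
      by (rule fsub_cong) (use assms(3) in \<open>auto split: nat.split\<close>)
    finally show ?thesis by simp
  qed
  ultimately show "shiftN ` G \<turnstile> q" by simp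
qed

lemma AllS_fresh:
  assumes "G \<turnstile> instS c q" "\<And>g. g \<in> G \<Longrightarrow> slev g \<le> c" "slev q \<le> Suc c"
  shows "G \<turnstile> AllS q"
proof (rule AllSI)
  let ?r = "\<lambda>i. if i = c then 0 else Suc i"
  have "fsub Var ?r ` G \<turnstile> fsub Var ?r (instS c q)"
    using assms(1) by (rule deriv_fsub)
  moreover have "fsub Var ?r ` G = shiftS ` G"
    unfolding shiftS_def by (intro image_cong refl fsub_cong) (use assms(2) in force)+
  moreover have "fsub Var ?r (instS c q) = q"
  proof -
    have "fsub Var ?r (instS c q) = fsub Var (\<lambda>i. ?r (case_nat c id i)) q"
      by (simp add: instS_def fsub_fsub)
    also have "\<dots> = fsub Var id q"
      by (rule fsub_cong) (use assms(3) in \<open>auto split: nat.split\<close>)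
    finally show ?thesis by simp
  qed
  ultimately show "shiftS ` G \<turnstile> q" by simp
qed

section \<open>Extending a consistent set of formulas to a Henkin set\<close>

definition closed_form :: "fm \<Rightarrow> bool" where
  "closed_form p \<longleftrightarrow> nlev p = 0 \<and> slev p = 0"

text \<open>The language gets no new constants: terms and free set variables serve as
  counterexamples to refuted universal statements.\<close>

definition henkin :: "fm set \<Rightarrow> bool" where
  "henkin H \<longleftrightarrow> \<not> H \<turnstile> Fls \<and> (\<forall>p. p \<in> H \<or> Neg p \<in> H) \<and>
    (\<forall>q. Neg (AllN q) \<in> H \<longrightarrow> (\<exists>t. Neg (instN t q) \<in> H)) \<and>
    (\<forall>q. Neg (AllS q) \<in> H \<longrightarrow> (\<exists>Y. Neg (instS Y q) \<in> H))"

lemma fresh_index: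
  assumes "finite {g \<in> G. \<not> closed_form g}"
  shows "\<exists>c. \<forall>g\<in>G. nlev g \<le> c \<and> slev g \<le> c"
proof -
  let ?f = "\<lambda>g. max (nlev g) (slev g)"
  have fin: "finite (insert 0 (?f ` {g \<in> G. \<not> closed_form g}))" using assms by simp
  have "?f g \<le> Max (insert 0 (?f ` {g \<in> G. \<not> closed_form g}))" if "g \<in> G" for g
  proof (cases "closed_form g")
    case True
    then show ?thesis by (simp add: closed_form_def)
  next
    case False
    with that have "?f g \<in> insert 0 (?f ` {g \<in> G. \<not> closed_form g})" by blast
    with fin show ?thesis by (rule Max_ge)
  qed
  then show ?thesis by (meson max.bounded_iff)
qed

lemma finite_not_closed_insert:
  "finite {g \<in> G. \<not> closed_form g} \<Longrightarrow> finite {g \<in> insert p G. \<not> closed_form g}"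
  by (rule finite_subset[of _ "insert p {g \<in> G. \<not> closed_form g}"]) auto

lemma henkin_step:
  assumes G: "\<not> G \<turnstile> Fls" "finite {g \<in> G. \<not> closed_form g}"
  shows "\<exists>G'. (\<not> G' \<turnstile> Fls \<and> finite {g \<in> G'. \<not> closed_form g}) \<and> G \<subseteq> G' \<and>
    (p \<in> G' \<or> Neg p \<in> G' \<and> (\<forall>q. p = AllN q \<longrightarrow> (\<exists>t. Neg (instN t q) \<in> G')) \<and>
      (\<forall>q. p = AllS q \<longrightarrow> (\<exists>Y. Neg (instS Y q) \<in> G')))"
proof (cases "insert p G \<turnstile> Fls")
  case False
  with finite_not_closed_insert[OF G(2)] show ?thesis
    by (intro exI[of _ "insert p G"]) blast
next
  case True
  let ?N = "insert (Neg p) G"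
  have N: "\<not> ?N \<turnstile> Fls"
    using True G(1) by (meson Contr ImpE ImpI)
  have Nf: "finite {g \<in> ?N. \<not> closed_form g}"
    using G(2) by (rule finite_not_closed_insert)
  have Np: "\<not> ?N \<turnstile> p"
    using N by (meson Assm ImpE insertI1)
  obtain c where c: "\<forall>g\<in>insert p ?N. nlev g \<le> c \<and> slev g \<le> c"
    using fresh_index finite_not_closed_insert Nf by metis
  consider q where "p = AllN q" | q where "p = AllS q"
    | "\<And>q. p \<noteq> AllN q" "\<And>q. p \<noteq> AllS q" by blast
  then show ?thesis
  proof cases
    case 1
    have "\<not> ?N \<turnstile> instN (Var c) q"
    proof
      assume "?N \<turnstile> instN (Var c) q"
      then have "?N \<turnstile> AllN q" by (rule AllN_fresh) (use c 1 in auto)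
      with Np 1 show False by simp
    qed
    then have "\<not> insert (Neg (instN (Var c) q)) ?N \<turnstile> Fls" using Contr by blast
    moreover have "(\<forall>q'. p = AllN q' \<longrightarrow> (\<exists>t. Neg (instN t q') \<in> insert (Neg (instN (Var c) q)) ?N))"
      "(\<forall>q'. p = AllS q' \<longrightarrow> (\<exists>Y. Neg (instS Y q') \<in> insert (Neg (instN (Var c) q)) ?N))"
      using 1 by (simp, blast?)+
    ultimately show ?thesis using finite_not_closed_insert[OF Nf]
      by (intro exI[of _ "insert (Neg (instN (Var c) q)) ?N"]) blast
  next
    case 2
    have "\<not> ?N \<turnstile> instS c q"
    proof
      assume "?N \<turnstile> instS c q"
      then have "?N \<turnstile> AllS q" by (rule AllS_fresh) (use c 2 in auto)
      with Np 2 show False by simp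
    qed
    then have "\<not> insert (Neg (instS c q)) ?N \<turnstile> Fls" using Contr by blast
    moreover have "(\<forall>q'. p = AllN q' \<longrightarrow> (\<exists>t. Neg (instN t q') \<in> insert (Neg (instS c q)) ?N))"
      "(\<forall>q'. p = AllS q' \<longrightarrow> (\<exists>Y. Neg (instS Y q') \<in> insert (Neg (instS c q)) ?N))"
      using 2 by (simp, blast?)+
    ultimately show ?thesis using finite_not_closed_insert[OF Nf]
      by (intro exI[of _ "insert (Neg (instS c q)) ?N"]) blast
  next
    case 3
    with N Nf show ?thesis by (intro exI[of _ ?N]) blast
  qed
qed

instance tm :: countable by countable_datatype
instance fm :: countable by countable_datatype

lemma henkin_extension:
  assumes "\<not> G \<turnstile> Fls" "finite {g \<in> G. \<not> closed_form g}"
  shows "\<exists>H. G \<subseteq> H \<and> henkin H"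
proof -
  define P where "P G \<longleftrightarrow> \<not> G \<turnstile> Fls \<and> finite {g \<in> G. \<not> closed_form g}" for G
  define Q where "Q p G G' \<longleftrightarrow> G \<subseteq> G' \<and>
    (p \<in> G' \<or> Neg p \<in> G' \<and> (\<forall>q. p = AllN q \<longrightarrow> (\<exists>t. Neg (instN t q) \<in> G')) \<and>
      (\<forall>q. p = AllS q \<longrightarrow> (\<exists>Y. Neg (instS Y q) \<in> G')))" for p G G'
  \<comment> \<open>Stage k settles the formula with number k in an enumeration of all formulas. The
    clause for k = 0 in the invariant pins the chain to start at \<open>G\<close>.\<close>
  have "\<exists>f. \<forall>k. (P (f k) \<and> ((k :: nat) = 0 \<longrightarrow> f k = G)) \<and> Q (from_nat k) (f k) (f (Suc k))"
  proof (rule dependent_nat_choice)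
    show "\<exists>x. P x \<and> ((0 :: nat) = 0 \<longrightarrow> x = G)" using assms unfolding P_def by blast
  next
    fix x and k :: nat
    assume "P x \<and> (k = 0 \<longrightarrow> x = G)"
    then obtain y where "P y" "Q (from_nat k) x y"
      using henkin_step[of x "from_nat k"] unfolding P_def Q_def by blast
    then show "\<exists>y. (P y \<and> (Suc k = 0 \<longrightarrow> y = G)) \<and> Q (from_nat k) x y" by auto
  qed
  then obtain f where f: "f 0 = G" "\<And>k. P (f k)" "\<And>k. Q (from_nat k) (f k) (f (Suc k))"
    by metis
  have mono: "f k \<subseteq> f l" if "k \<le> l" for k l
    using that f(3) unfolding Q_def by (metis lift_Suc_mono_le)
  define H where "H = (\<Union>k. f k)"
  have cons: "\<not> H \<turnstile> Fls"
  proof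
    assume "H \<turnstile> Fls"
    then obtain F where F: "finite F" "F \<subseteq> H" "F \<turnstile> Fls" using deriv_finite by blast
    have "\<exists>k. F \<subseteq> f k"
      using F(1,2)
    proof (induction F)
      case (insert x F)
      then obtain k l where "F \<subseteq> f k" "x \<in> f l" unfolding H_def by auto
      then have "insert x F \<subseteq> f (max k l)"
        using mono[of k "max k l"] mono[of l "max k l"] by auto
      then show ?case by blast
    qed simp
    then show False using F(3) f(2) deriv_mono unfolding P_def by blast
  qed
  have dec: "p \<in> H \<or> Neg p \<in> H \<and> (\<forall>q. p = AllN q \<longrightarrow> (\<exists>t. Neg (instN t q) \<in> H)) \<and>
      (\<forall>q. p = AllS q \<longrightarrow> (\<exists>Y. Neg (instS Y q) \<in> H))" for p
    using f(3)[of "to_nat p"] unfolding H_def Q_def from_nat_to_nat by blast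
  have "\<not> (p \<in> H \<and> Neg p \<in> H)" for p
    using cons by (meson Assm ImpE)
  then have "henkin H"
    unfolding henkin_def using cons dec by blast
  moreover have "G \<subseteq> H" using f(1) unfolding H_def by blast
  ultimately show ?thesis by blast
qed


section \<open>Structures for second-order arithmetic\<close>

text \<open>Set quantifiers range over \<open>m_sets\<close> only. Sets are genuine subsets of the
  domain, which costs nothing since the language has no equality between sets.\<close>

record 'a model =
  m_zero :: 'a
  m_one :: 'a
  m_add :: "'a \<Rightarrow> 'a \<Rightarrow> 'a"
  m_mul :: "'a \<Rightarrow> 'a \<Rightarrow> 'a"
  m_less :: "'a \<Rightarrow> 'a \<Rightarrow> bool"
  m_sets :: "'a set set"

primrec eval :: "'a model \<Rightarrow> (nat \<Rightarrow> 'a) \<Rightarrow> tm \<Rightarrow> 'a" where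
  "eval M \<nu> (Var i) = \<nu> i"
| "eval M \<nu> Zero = m_zero M"
| "eval M \<nu> One = m_one M"
| "eval M \<nu> (Add t u) = m_add M (eval M \<nu> t) (eval M \<nu> u)"
| "eval M \<nu> (Mul t u) = m_mul M (eval M \<nu> t) (eval M \<nu> u)"

primrec sat :: "'a model \<Rightarrow> (nat \<Rightarrow> 'a) \<Rightarrow> (nat \<Rightarrow> 'a set) \<Rightarrow> fm \<Rightarrow> bool" where
  "sat M \<nu> \<sigma> (Eq t u) \<longleftrightarrow> eval M \<nu> t = eval M \<nu> u"
| "sat M \<nu> \<sigma> (Less t u) \<longleftrightarrow> m_less M (eval M \<nu> t) (eval M \<nu> u)"
| "sat M \<nu> \<sigma> (Mem t X) \<longleftrightarrow> eval M \<nu> t \<in> \<sigma> X"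
| "sat M \<nu> \<sigma> Fls \<longleftrightarrow> False"
| "sat M \<nu> \<sigma> (Imp p q) \<longleftrightarrow> (sat M \<nu> \<sigma> p \<longrightarrow> sat M \<nu> \<sigma> q)"
| "sat M \<nu> \<sigma> (AllN p) \<longleftrightarrow> (\<forall>x. sat M (case_nat x \<nu>) \<sigma> p)"
| "sat M \<nu> \<sigma> (AllS p) \<longleftrightarrow> (\<forall>X\<in>m_sets M. sat M \<nu> (case_nat X \<sigma>) p)"

definition valid :: "'a model \<Rightarrow> fm \<Rightarrow> bool" where
  "valid M p \<longleftrightarrow> (\<forall>\<nu> \<sigma>. range \<sigma> \<subseteq> m_sets M \<longrightarrow> sat M \<nu> \<sigma> p)"

lemma eval_tsub: "eval M \<nu> (tsub s t) = eval M (\<lambda>i. eval M \<nu> (s i)) t"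
  by (induction t) auto

lemma eval_lift: "eval M \<nu> (lift k t) = eval M (\<lambda>i. \<nu> (i + k)) t"
  by (simp add: lift_def eval_tsub)

lemma sat_fsub:
  "sat M \<nu> \<sigma> (fsub s r p) \<longleftrightarrow> sat M (\<lambda>i. eval M \<nu> (s i)) (\<lambda>i. \<sigma> (r i)) p"
proof (induction p arbitrary: \<nu> \<sigma> s r)
  case (AllN p)
  have "(\<lambda>i. eval M (case_nat x \<nu>) (case_nat (Var 0) (\<lambda>i. lift 1 (s i)) i)) =
      case_nat x (\<lambda>i. eval M \<nu> (s i))" for x
    by (rule ext) (simp add: eval_lift split: nat.split)
  then show ?case by (simp add: AllN del: One_nat_def)
next
  case (AllS p)
  have "(\<lambda>i. case_nat X \<sigma> (case_nat 0 (\<lambda>i. Suc (r i)) i)) = case_nat X (\<lambda>i. \<sigma> (r i))" for X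
    by (rule ext) (simp split: nat.split)
  then show ?case by (simp add: AllS)
qed (simp_all add: eval_tsub)

lemma eval_instN_env: "(\<lambda>i. eval M \<nu> (case_nat t Var i)) = case_nat (eval M \<nu> t) \<nu>"
  by (rule ext) (simp split: nat.split)

lemma sat_instN: "sat M \<nu> \<sigma> (instN t p) \<longleftrightarrow> sat M (case_nat (eval M \<nu> t) \<nu>) \<sigma> p"
  by (simp add: instN_def sat_fsub eval_instN_env)

lemma sat_shiftS: "sat M \<nu> \<sigma> (shiftS p) \<longleftrightarrow> sat M \<nu> (\<lambda>i. \<sigma> (Suc i)) p"
  by (simp add: shiftS_def sat_fsub)

lemma eval_cong: "(\<And>i. i < tlev t \<Longrightarrow> \<nu> i = \<nu>' i) \<Longrightarrow> eval M \<nu> t = eval M \<nu>' t"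
  by (induction t) auto

lemma sat_cong:
  "\<lbrakk>\<And>i. i < nlev p \<Longrightarrow> \<nu> i = \<nu>' i; \<And>i. i < slev p \<Longrightarrow> \<sigma> i = \<sigma>' i\<rbrakk> \<Longrightarrow>
    sat M \<nu> \<sigma> p \<longleftrightarrow> sat M \<nu>' \<sigma>' p"
proof (induction p arbitrary: \<nu> \<nu>' \<sigma> \<sigma>')
  case (Eq t u)
  then show ?case using eval_cong[of t \<nu> \<nu>' M] eval_cong[of u \<nu> \<nu>' M] by simp
next
  case (Less t u)
  then show ?case using eval_cong[of t \<nu> \<nu>' M] eval_cong[of u \<nu> \<nu>' M] by simp
next
  case (Mem t X)
  then show ?case using eval_cong[of t \<nu> \<nu>' M] by simp
next
  case Fls
  then show ?case by simp
next
  case (Imp p q)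
  have "sat M \<nu> \<sigma> p = sat M \<nu>' \<sigma>' p" "sat M \<nu> \<sigma> q = sat M \<nu>' \<sigma>' q"
    by (rule Imp.IH; simp add: Imp.prems)+
  then show ?case by simp
next
  case (AllN p)
  have "sat M (case_nat x \<nu>) \<sigma> p = sat M (case_nat x \<nu>') \<sigma>' p" for x
    by (rule AllN.IH) (use AllN.prems in \<open>simp_all split: nat.split\<close>)
  then show ?case by simp
next
  case (AllS p)
  have "sat M \<nu> (case_nat X \<sigma>) p = sat M \<nu>' (case_nat X \<sigma>') p" for X
    by (rule AllS.IH) (use AllS.prems in \<open>simp_all split: nat.split\<close>)
  then show ?case by simp
qed

lemma valid_AllN [simp]: "valid M (AllN p) \<longleftrightarrow> valid M p"
proof
  assume L: "valid M (AllN p)"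
  show "valid M p"
    unfolding valid_def
  proof (intro allI impI)
    fix \<nu> and \<sigma> :: "nat \<Rightarrow> _ set"
    assume "range \<sigma> \<subseteq> m_sets M"
    then have "sat M (case_nat (\<nu> 0) (\<lambda>i. \<nu> (Suc i))) \<sigma> p" using L by (simp add: valid_def)
    moreover have "case_nat (\<nu> 0) (\<lambda>i. \<nu> (Suc i)) = \<nu>" by (rule ext) (simp split: nat.split)
    ultimately show "sat M \<nu> \<sigma> p" by simp
  qed
qed (simp add: valid_def)

lemma range_case_nat [simp]: "range (case_nat X \<sigma>) \<subseteq> S \<longleftrightarrow> X \<in> S \<and> range \<sigma> \<subseteq> S"
  by (auto simp: image_subset_iff split: nat.splits)

lemma valid_AllS [simp]: "valid M (AllS p) \<longleftrightarrow> valid M p"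
proof
  assume L: "valid M (AllS p)"
  show "valid M p"
    unfolding valid_def
  proof (intro allI impI)
    fix \<nu> and \<sigma> :: "nat \<Rightarrow> _ set"
    assume "range \<sigma> \<subseteq> m_sets M"
    then have "range (\<lambda>i. \<sigma> (Suc i)) \<subseteq> m_sets M" "\<sigma> 0 \<in> m_sets M" by auto
    then have "sat M \<nu> (case_nat (\<sigma> 0) (\<lambda>i. \<sigma> (Suc i))) p" using L by (simp add: valid_def)
    moreover have "case_nat (\<sigma> 0) (\<lambda>i. \<sigma> (Suc i)) = \<sigma>" by (rule ext) (simp split: nat.split)
    ultimately show "sat M \<nu> \<sigma> p" by simp
  qed
qed (simp add: valid_def)

text \<open>\<open>valid\<close> already ranges over all assignments, so the axioms can be used in
  open form.\<close>

lemma valid_ucl [simp]: "valid M (ucl p) \<longleftrightarrow> valid M p"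
proof -
  have "valid M ((AllN ^^ k) q) \<longleftrightarrow> valid M q" for k q by (induction k) auto
  moreover have "valid M ((AllS ^^ k) q) \<longleftrightarrow> valid M q" for k q by (induction k) auto
  ultimately show ?thesis by (simp add: ucl_def)
qed

lemma closed_form_ucl: "closed_form (ucl p)"
proof -
  have "nlev ((AllN ^^ k) q) = nlev q - k \<and> slev ((AllN ^^ k) q) = slev q" for k q
    by (induction k) auto
  moreover have "slev ((AllS ^^ k) q) = slev q - k \<and> nlev ((AllS ^^ k) q) = nlev q" for k q
    by (induction k) auto
  ultimately show ?thesis by (simp add: closed_form_def ucl_def)
qed

section \<open>The term model of a Henkin set\<close>

context
  fixes H :: "fm set"
  assumes H: "henkin H"
begin

lemma henkin_deriv: "H \<turnstile> p \<longleftrightarrow> p \<in> H"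
  using H unfolding henkin_def by (meson Assm ImpE)

lemma henkin_Fls: "Fls \<notin> H"
  using H henkin_deriv unfolding henkin_def by blast

lemma henkin_Neg: "Neg p \<in> H \<longleftrightarrow> p \<notin> H"
  using H unfolding henkin_def by (meson Assm ImpE)

lemma henkin_Imp: "Imp p q \<in> H \<longleftrightarrow> (p \<in> H \<longrightarrow> q \<in> H)"
proof
  assume "Imp p q \<in> H"
  then show "p \<in> H \<longrightarrow> q \<in> H" using henkin_deriv by (meson Assm ImpE)
next
  assume A: "p \<in> H \<longrightarrow> q \<in> H"
  have "insert p H \<turnstile> q"
  proof (cases "p \<in> H")
    case True
    with A show ?thesis by (auto intro: Assm)
  next
    case False
    then have "Neg p \<in> H" by (simp add: henkin_Neg)
    then have "insert p H \<turnstile> Fls" by (meson Assm ImpE insertI1 insertI2)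
    then show ?thesis using Contr deriv_mono by (meson subset_insertI)
  qed
  then show "Imp p q \<in> H" using henkin_deriv ImpI by blast
qed

lemma henkin_AllN: "AllN q \<in> H \<longleftrightarrow> (\<forall>t. instN t q \<in> H)"
proof
  assume "AllN q \<in> H"
  then show "\<forall>t. instN t q \<in> H" using henkin_deriv AllNE by metis
next
  assume "\<forall>t. instN t q \<in> H"
  then have "Neg (AllN q) \<notin> H" using H henkin_Neg unfolding henkin_def by metis
  then show "AllN q \<in> H" by (simp add: henkin_Neg)
qed

lemma henkin_AllS: "AllS q \<in> H \<longleftrightarrow> (\<forall>Y. instS Y q \<in> H)"
proof
  assume "AllS q \<in> H"
  then show "\<forall>Y. instS Y q \<in> H" using henkin_deriv AllSE by metis
next
  assume "\<forall>Y. instS Y q \<in> H"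
  then have "Neg (AllS q) \<notin> H" using H henkin_Neg unfolding henkin_def by metis
  then show "AllS q \<in> H" by (simp add: henkin_Neg)
qed

lemma henkin_subst: "Eq t u \<in> H \<Longrightarrow> instN t p \<in> H \<Longrightarrow> instN u p \<in> H"
  using henkin_deriv EqSubst by metis

lemma henkin_refl: "Eq t t \<in> H"
  using henkin_deriv EqRefl by metis

text \<open>This and the congruence laws below come from the substitution rule: number variable 0
  marks the place of replacement, and the other terms are lifted past it.\<close>

lemma henkin_sym: "Eq t u \<in> H \<Longrightarrow> Eq u t \<in> H"
  using henkin_subst[of t u "Eq (Var 0) (lift 1 t)"] henkin_refl
  by (simp add: instN_def tsub_lift)

lemma henkin_trans: "Eq t u \<in> H \<Longrightarrow> Eq u v \<in> H \<Longrightarrow> Eq t v \<in> H"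
  using henkin_subst[of u v "Eq (lift 1 t) (Var 0)"] by (simp add: instN_def tsub_lift)

lemma henkin_Add: "Eq t t' \<in> H \<Longrightarrow> Eq u u' \<in> H \<Longrightarrow> Eq (Add t u) (Add t' u') \<in> H"
  using henkin_subst[of t t' "Eq (lift 1 (Add t u)) (Add (Var 0) (lift 1 u))"]
    henkin_subst[of u u' "Eq (lift 1 (Add t u)) (Add (lift 1 t') (Var 0))"] henkin_refl
  by (simp add: instN_def tsub_lift)

lemma henkin_Mul: "Eq t t' \<in> H \<Longrightarrow> Eq u u' \<in> H \<Longrightarrow> Eq (Mul t u) (Mul t' u') \<in> H"
  using henkin_subst[of t t' "Eq (lift 1 (Mul t u)) (Mul (Var 0) (lift 1 u))"]
    henkin_subst[of u u' "Eq (lift 1 (Mul t u)) (Mul (lift 1 t') (Var 0))"] henkin_refl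
  by (simp add: instN_def tsub_lift)

lemma henkin_Less: "Eq t t' \<in> H \<Longrightarrow> Eq u u' \<in> H \<Longrightarrow> Less t u \<in> H \<Longrightarrow> Less t' u' \<in> H"
  using henkin_subst[of t t' "Less (Var 0) (lift 1 u)"]
    henkin_subst[of u u' "Less (lift 1 t') (Var 0)"]
  by (simp add: instN_def tsub_lift)

lemma henkin_Mem: "Eq t t' \<in> H \<Longrightarrow> Mem t X \<in> H \<Longrightarrow> Mem t' X \<in> H"
  using henkin_subst[of t t' "Mem (Var 0) X"] by (simp add: instN_def)

text \<open>The term model is to live on \<open>nat\<close>, which requires infinitely many classes
  of provably equal terms. The successor axioms keep the numerals \<open>num k\<close>
  apart.\<close>

lemma henkin_infinite:
  assumes "ucl ` basic_axioms \<subseteq> H"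
  shows "infinite (range (\<lambda>t. {u. Eq t u \<in> H}))"
proof -
  define num where "num = rec_nat Zero (\<lambda>_ t. Add t One)"
  have num: "num 0 = Zero" "num (Suc k) = Add (num k) One" for k by (simp_all add: num_def)
  have "AllN (Neg (Eq (Add (Var 0) One) Zero)) \<in> H"
    using assms by (simp add: basic_axioms_def Let_def ucl_def)
  then have 1: "Eq (Add t One) Zero \<notin> H" for t
    by (auto simp: henkin_AllN henkin_Imp henkin_Fls instN_def)
  have ax: "AllN (AllN (Imp (Eq (Add (Var 1) One) (Add (Var 0) One)) (Eq (Var 1) (Var 0)))) \<in> H"
    using assms by (simp add: basic_axioms_def Let_def ucl_def numeral_2_eq_2)
  have 2: "Eq (Add t One) (Add u One) \<in> H \<Longrightarrow> Eq t u \<in> H" for t u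
  proof -
    assume "Eq (Add t One) (Add u One) \<in> H"
    moreover have "instN t (AllN (Imp (Eq (Add (Var 1) One) (Add (Var 0) One)) (Eq (Var 1) (Var 0)))) \<in> H"
      using ax henkin_AllN by blast
    then have "AllN (Imp (Eq (Add (lift 1 t) One) (Add (Var 0) One)) (Eq (lift 1 t) (Var 0))) \<in> H"
      by (simp add: instN_def)
    then have "instN u (Imp (Eq (Add (lift 1 t) One) (Add (Var 0) One)) (Eq (lift 1 t) (Var 0))) \<in> H"
      using henkin_AllN by blast
    ultimately show ?thesis by (simp add: instN_def tsub_lift henkin_Imp)
  qed
  have 3: "Eq (num k) (num l) \<in> H \<Longrightarrow> k = l" for k l
  proof (induction k arbitrary: l)
    case 0
    then show ?case using 1 henkin_sym by (cases l) (auto simp: num)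
  next
    case (Suc k)
    then show ?case using 1 2 by (cases l) (auto simp: num)
  qed
  have "inj (\<lambda>k. {u. Eq (num k) u \<in> H})"
    by (rule injI) (use 3 henkin_refl in blast)
  then have "infinite (range (\<lambda>k. {u. Eq (num k) u \<in> H}))"
    using finite_imageD by blast
  then show ?thesis by (rule contrapos_nn) (auto elim: finite_subset[rotated])
qed

lemma henkin_model:
  assumes "ucl ` basic_axioms \<subseteq> H"
  shows "\<exists>M :: nat model. m_sets M \<noteq> {} \<and> (\<forall>p. closed_form p \<longrightarrow> (valid M p \<longleftrightarrow> p \<in> H))"
proof -
  let ?c = "\<lambda>t. {u. Eq t u \<in> H}"
  have c: "?c t = ?c u \<longleftrightarrow> Eq t u \<in> H" for t u
    using henkin_refl henkin_sym henkin_trans by blast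
  \<comment> \<open>Elements of the model are the numbers of equality classes: \<open>h\<close>
    numbers the class of a term, and \<open>g\<close> below chooses a term for each number.\<close>
  define h where "h t = to_nat_on (range ?c) (?c t)" for t
  have bij: "bij_betw (to_nat_on (range ?c)) (range ?c) UNIV"
    by (rule to_nat_on_infinite) (use henkin_infinite[OF assms] in auto)
  have h: "h t = h u \<longleftrightarrow> Eq t u \<in> H" for t u
  proof -
    have "h t = h u \<longleftrightarrow> ?c t = ?c u"
      unfolding h_def using bij_betw_imp_inj_on[OF bij] by (rule inj_on_eq_iff) auto
    with c show ?thesis by simp
  qed
  have surj: "\<exists>t. x = h t" for x
  proof -
    have "x \<in> to_nat_on (range ?c) ` range ?c" using bij_betw_imp_surj_on[OF bij] by simp
    then show ?thesis unfolding h_def by blast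
  qed
  define g where "g x = (SOME t. h t = x)" for x
  have hg [simp]: "h (g x) = x" for x
    unfolding g_def by (rule someI_ex) (metis surj)
  have gh: "Eq (g (h t)) t \<in> H" for t using h hg by metis
  define ex where "ex X = {x. Mem (g x) X \<in> H}" for X
  define M where "M = \<lparr>m_zero = h Zero, m_one = h One, m_add = (\<lambda>x y. h (Add (g x) (g y))),
    m_mul = (\<lambda>x y. h (Mul (g x) (g y))), m_less = (\<lambda>x y. Less (g x) (g y) \<in> H), m_sets = range ex\<rparr>"
  have ev: "eval M (\<lambda>i. h (s i)) t = h (tsub s t)" for s t
  proof (induction t)
    case (Add t u)
    then show ?case by (simp add: M_def h henkin_Add gh)
  next
    case (Mul t u)
    then show ?case by (simp add: M_def h henkin_Mul gh)
  qed (simp_all add: M_def)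
  have less: "m_less M (h t) (h u) \<longleftrightarrow> Less t u \<in> H" for t u
    using gh henkin_sym henkin_Less by (simp add: M_def) blast
  have mem: "h t \<in> ex X \<longleftrightarrow> Mem t X \<in> H" for t X
    using gh henkin_sym henkin_Mem by (simp add: ex_def) blast
  \<comment> \<open>The truth lemma is stated for arbitrary terms and set variables as values,
    because the quantifier cases extend the assignment. They go through since every element is some
    \<open>h t\<close> and every set some \<open>ex Y\<close>.\<close>
  have truth: "sat M (\<lambda>i. h (s i)) (\<lambda>i. ex (r i)) p \<longleftrightarrow> fsub s r p \<in> H" for s r p
  proof (induction p arbitrary: s r)
    case (AllN p)
    have "case_nat (h t) (\<lambda>i. h (s i)) = (\<lambda>i. h (case_nat t s i))" for t
      by (rule ext) (simp split: nat.split)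
    then have "sat M (case_nat (h t) (\<lambda>i. h (s i))) (\<lambda>i. ex (r i)) p \<longleftrightarrow>
        fsub (case_nat t s) r p \<in> H" for t
      by (simp add: AllN)
    then have "sat M (\<lambda>i. h (s i)) (\<lambda>i. ex (r i)) (AllN p) \<longleftrightarrow> (\<forall>t. fsub (case_nat t s) r p \<in> H)"
      using surj by simp metis
    then show ?case by (simp add: henkin_AllN instN_fsub del: One_nat_def sat.simps)
  next
    case (AllS p)
    have "case_nat (ex Y) (\<lambda>i. ex (r i)) = (\<lambda>i. ex (case_nat Y r i))" for Y
      by (rule ext) (simp split: nat.split)
    then have "sat M (\<lambda>i. h (s i)) (case_nat (ex Y) (\<lambda>i. ex (r i))) p \<longleftrightarrow>
        fsub s (case_nat Y r) p \<in> H" for Y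
      by (simp add: AllS)
    moreover have "m_sets M = range ex" by (simp add: M_def)
    ultimately show ?case by (simp add: henkin_AllS instS_fsub)
  qed (simp_all add: ev h less mem henkin_Fls henkin_Imp)
  have "valid M p \<longleftrightarrow> p \<in> H" if "closed_form p" for p
  proof -
    have "sat M \<nu> \<sigma> p \<longleftrightarrow> sat M (\<lambda>i. h (Var i)) (\<lambda>i. ex i) p" for \<nu> \<sigma>
      by (rule sat_cong) (use that in \<open>auto simp: closed_form_def\<close>)
    then have "sat M \<nu> \<sigma> p \<longleftrightarrow> p \<in> H" for \<nu> \<sigma>
      using truth[of Var id p] by simp
    moreover have "range ex \<subseteq> m_sets M" by (simp add: M_def)
    ultimately show ?thesis unfolding valid_def by blast
  qed
  moreover have "m_sets M \<noteq> {}" by (simp add: M_def)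
  ultimately show ?thesis by blast
qed

end

text \<open>A statement cannot quantify over all types, so the semantic hypothesis speaks of one
  domain only. Domain \<open>nat\<close> is enough, since the terms are countable and the basic
  axioms make infinitely many of them distinct.\<close>

theorem completeness:
  assumes T: "ucl ` basic_axioms \<subseteq> T" "\<And>p. p \<in> T \<Longrightarrow> closed_form p" and \<chi>: "closed_form \<chi>"
    and sem: "\<And>M :: nat model. m_sets M \<noteq> {} \<Longrightarrow> (\<And>p. p \<in> T \<Longrightarrow> valid M p) \<Longrightarrow> valid M \<chi>"
  shows "T \<turnstile> \<chi>"
proof (rule ccontr)
  assume "\<not> T \<turnstile> \<chi>"
  then have "\<not> insert (Neg \<chi>) T \<turnstile> Fls" using Contr by blast
  moreover have "finite {g \<in> insert (Neg \<chi>) T. \<not> closed_form g}"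
    using T(2) by (intro finite_not_closed_insert) (metis (mono_tags, lifting) Collect_empty_eq finite.emptyI)
  ultimately obtain H where H: "insert (Neg \<chi>) T \<subseteq> H" "henkin H"
    using henkin_extension by blast
  then obtain M :: "nat model" where "m_sets M \<noteq> {}"
    and M: "\<And>p. closed_form p \<Longrightarrow> valid M p \<longleftrightarrow> p \<in> H"
    using henkin_model[of H] T(1) by blast
  then have "valid M \<chi>" using sem H(1) T(2) by blast
  then show False using M[OF \<chi>] H henkin_Neg by auto
qed


section \<open>Definable predicates\<close>

lemma bounded_fm_fsub: "bounded_fm p \<Longrightarrow> bounded_fm (fsub s r p)"
proof (induction arbitrary: s r rule: bounded_fm.induct)
  case (6 p t)
  then show ?case using bounded_fm.intros(6) by (simp add: tsub_up_lift del: One_nat_def)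
next
  case (7 p t)
  then show ?case using bounded_fm.intros(7) by (simp add: tsub_up_lift del: One_nat_def)
qed (auto intro: bounded_fm.intros)

text \<open>A formula reads one sequence of number variables. Even places carry the arguments of a
  predicate, odd places the elements of the model used as parameters.\<close>

definition mix :: "(nat \<Rightarrow> 'b) \<Rightarrow> (nat \<Rightarrow> 'b) \<Rightarrow> nat \<Rightarrow> 'b" where
  "mix f g i = (if even i then f (i div 2) else g (i div 2))"

lemma mix_even [simp]: "mix f g (2 * i) = f i"
  by (simp add: mix_def)

lemma mix_odd [simp]: "mix f g (Suc (2 * i)) = g i"
  by (simp add: mix_def)

text \<open>Renamings that carry a pair of parameter sequences into their joint sequence.\<close>

definition inl :: "nat \<Rightarrow> nat" where "inl i = (if even i then i else Suc (2 * (i - 1)))"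
definition inr :: "nat \<Rightarrow> nat" where "inr i = (if even i then i else Suc (2 * i))"

lemma mix_inl: "mix f (mix g g') (inl i) = mix f g i"
  by (cases "even i") (auto elim!: oddE simp: mix_def inl_def)

lemma mix_inr: "mix f (mix g' g) (inr i) = mix f g i"
  by (cases "even i") (auto elim!: oddE simp: mix_def inr_def)

lemma range_mix: "range f \<subseteq> A \<Longrightarrow> range g \<subseteq> A \<Longrightarrow> range (mix f g) \<subseteq> A"
  by (auto simp: mix_def)

text \<open>The least that all the theories have in common. \<open>all_comprehension\<close> allows
  set parameters, so it can be iterated and reaches all arithmetical formulas.\<close>

locale ca_model =
  fixes M :: "'a model"
  assumes sets_nonempty: "m_sets M \<noteq> {}"
    and basic: "p \<in> basic_axioms \<Longrightarrow> valid M p"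
    and induction: "p \<in> Sigma_fm 0 1 \<Longrightarrow> valid M (induction_ax p)"
    and all_comprehension: "bounded_fm p \<Longrightarrow> range \<sigma> \<subseteq> m_sets M \<Longrightarrow>
      {x. sat M (case_nat x \<nu>) \<sigma> (AllN p)} \<in> m_sets M"
begin

abbreviation zer ("\<zero>") where "\<zero> \<equiv> m_zero M"
abbreviation uno ("\<one>") where "\<one> \<equiv> m_one M"
abbreviation pls (infixl "\<oplus>" 65) where "x \<oplus> y \<equiv> m_add M x y"
abbreviation tms (infixl "\<otimes>" 70) where "x \<otimes> y \<equiv> m_mul M x y"
abbreviation les (infix "\<prec>" 50) where "x \<prec> y \<equiv> m_less M x y"

text \<open>Functions of an assignment replace syntactic terms, so definability can be proved by
  introduction rules on readable predicates instead of by writing de Bruijn formulas.\<close>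

inductive dterm :: "((nat \<Rightarrow> 'a) \<Rightarrow> 'a) \<Rightarrow> bool" where
  dterm_var: "dterm (\<lambda>\<nu>. \<nu> i)"
| dterm_const: "dterm (\<lambda>\<nu>. c)"
| dterm_add: "dterm t \<Longrightarrow> dterm u \<Longrightarrow> dterm (\<lambda>\<nu>. t \<nu> \<oplus> u \<nu>)"
| dterm_mul: "dterm t \<Longrightarrow> dterm u \<Longrightarrow> dterm (\<lambda>\<nu>. t \<nu> \<otimes> u \<nu>)"

text \<open>The predicates given by bounded formulas with parameters, presented through their closure
  properties.  In presence of \<open>all_comprehension\<close> they turn out to be closed under unbounded
  number quantification as well.\<close>

inductive dpred :: "((nat \<Rightarrow> 'a) \<Rightarrow> bool) \<Rightarrow> bool" where
  dpred_eq: "dterm t \<Longrightarrow> dterm u \<Longrightarrow> dpred (\<lambda>\<nu>. t \<nu> = u \<nu>)"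
| dpred_less: "dterm t \<Longrightarrow> dterm u \<Longrightarrow> dpred (\<lambda>\<nu>. t \<nu> \<prec> u \<nu>)"
| dpred_mem: "dterm t \<Longrightarrow> X \<in> m_sets M \<Longrightarrow> dpred (\<lambda>\<nu>. t \<nu> \<in> X)"
| dpred_False: "dpred (\<lambda>\<nu>. False)"
| dpred_imp: "dpred P \<Longrightarrow> dpred Q \<Longrightarrow> dpred (\<lambda>\<nu>. P \<nu> \<longrightarrow> Q \<nu>)"
| dpred_ball: "dterm t \<Longrightarrow> dpred (\<lambda>\<nu>. P (\<nu> 0) (\<lambda>i. \<nu> (Suc i))) \<Longrightarrow>
    dpred (\<lambda>\<nu>. \<forall>x. x \<prec> t \<nu> \<longrightarrow> P x \<nu>)"

lemma dpred_const: "dpred (\<lambda>\<nu>. c)"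
  using dpred_False dpred_imp[OF dpred_False dpred_False] by (cases c) simp_all

lemma dpred_not: "dpred P \<Longrightarrow> dpred (\<lambda>\<nu>. \<not> P \<nu>)"
  using dpred_imp[OF _ dpred_False] by simp

lemma dpred_conj: "dpred P \<Longrightarrow> dpred Q \<Longrightarrow> dpred (\<lambda>\<nu>. P \<nu> \<and> Q \<nu>)"
  using dpred_not[OF dpred_imp[OF _ dpred_not, of P Q]] by simp

lemma dpred_disj: "dpred P \<Longrightarrow> dpred Q \<Longrightarrow> dpred (\<lambda>\<nu>. P \<nu> \<or> Q \<nu>)"
  using dpred_imp[OF dpred_not, of P Q] by (simp add: disj_imp)

lemma dpred_iff: "dpred P \<Longrightarrow> dpred Q \<Longrightarrow> dpred (\<lambda>\<nu>. P \<nu> \<longleftrightarrow> Q \<nu>)"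
  unfolding iff_conv_conj_imp by (intro dpred_conj dpred_imp)

lemma dpred_bex:
  "dterm t \<Longrightarrow> dpred (\<lambda>\<nu>. P (\<nu> 0) (\<lambda>i. \<nu> (Suc i))) \<Longrightarrow> dpred (\<lambda>\<nu>. \<exists>x. x \<prec> t \<nu> \<and> P x \<nu>)"
  using dpred_not[OF dpred_ball[of t "\<lambda>x \<nu>. \<not> P x \<nu>", OF _ dpred_not]] by simp

lemmas dintros = dpred_eq dpred_less dpred_mem dpred_imp dpred_not dpred_conj dpred_disj dpred_iff
  dpred_const dterm.intros

lemma dterm_subst: "dterm t \<Longrightarrow> (\<And>i. dterm (s i)) \<Longrightarrow> dterm (\<lambda>\<nu>. t (\<lambda>i. s i \<nu>))"
  by (induction rule: dterm.induct) (auto intro: dterm.intros)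

lemma dpred_subst: "dpred P \<Longrightarrow> (\<And>i. dterm (s i)) \<Longrightarrow> dpred (\<lambda>\<nu>. P (\<lambda>i. s i \<nu>))"
proof (induction arbitrary: s rule: dpred.induct)
  case (dpred_ball t P)
  let ?s = "\<lambda>i \<nu>. case i of 0 \<Rightarrow> \<nu> 0 | Suc i \<Rightarrow> s i (\<lambda>i. \<nu> (Suc i))"
  have "dterm (?s i)" for i
    using dterm_subst[OF dpred_ball.prems, where s = "\<lambda>i \<nu>. \<nu> (Suc i)"]
    by (cases i) (auto intro: dterm.intros)
  then have "dpred (\<lambda>\<nu>. P (?s 0 \<nu>) (\<lambda>i. ?s (Suc i) \<nu>))"
    by (rule dpred_ball.IH)
  then show ?case
    using dpred.dpred_ball[OF dterm_subst[OF dpred_ball.hyps(1) dpred_ball.prems],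
        of "\<lambda>x \<nu>. P x (\<lambda>i. s i \<nu>)"] by simp
next
  case (dpred_eq t u)
  then show ?case by (intro dpred.dpred_eq[OF dterm_subst dterm_subst])
next
  case (dpred_less t u)
  then show ?case by (intro dpred.dpred_less[OF dterm_subst dterm_subst])
next
  case (dpred_mem t X)
  then show ?case by (intro dpred.dpred_mem[OF dterm_subst])
next
  case (dpred_imp P Q)
  then show ?case by (intro dpred.dpred_imp) simp_all
next
  case dpred_False
  show ?case by (rule dpred.dpred_False)
qed

text \<open>Finite support is what allows all parameters to be merged into one by finitely many
  pairings.\<close>

lemma dpred_support: "dpred P \<Longrightarrow> \<exists>k. \<forall>\<nu> \<nu>'. (\<forall>i<k. \<nu> i = \<nu>' i) \<longrightarrow> P \<nu> = P \<nu>'"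
proof -
  have T: "\<exists>k. \<forall>\<nu> \<nu>'. (\<forall>i<k. \<nu> i = \<nu>' i) \<longrightarrow> t \<nu> = t \<nu>'" if "dterm t" for t
    using that
  proof (induction rule: dterm.induct)
    case (dterm_var i)
    show ?case by (rule exI[of _ "Suc i"]) simp
  next
    case (dterm_add t u)
    then obtain k l where "\<forall>\<nu> \<nu>'. (\<forall>i<k. \<nu> i = \<nu>' i) \<longrightarrow> t \<nu> = t \<nu>'"
      "\<forall>\<nu> \<nu>'. (\<forall>i<l. \<nu> i = \<nu>' i) \<longrightarrow> u \<nu> = u \<nu>'" by blast
    then show ?case by (intro exI[of _ "max k l"]) (metis less_max_iff_disj)
  next
    case (dterm_mul t u)
    then obtain k l where "\<forall>\<nu> \<nu>'. (\<forall>i<k. \<nu> i = \<nu>' i) \<longrightarrow> t \<nu> = t \<nu>'"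
      "\<forall>\<nu> \<nu>'. (\<forall>i<l. \<nu> i = \<nu>' i) \<longrightarrow> u \<nu> = u \<nu>'" by blast
    then show ?case by (intro exI[of _ "max k l"]) (metis less_max_iff_disj)
  qed simp
  show "dpred P \<Longrightarrow> ?thesis"
  proof (induction rule: dpred.induct)
    case (dpred_eq t u)
    from T[OF this(1)] T[OF this(2)] obtain k l where
      "\<forall>\<nu> \<nu>'. (\<forall>i<k. \<nu> i = \<nu>' i) \<longrightarrow> t \<nu> = t \<nu>'"
      "\<forall>\<nu> \<nu>'. (\<forall>i<l. \<nu> i = \<nu>' i) \<longrightarrow> u \<nu> = u \<nu>'" by blast
    then show ?case by (intro exI[of _ "max k l"]) (metis less_max_iff_disj)
  next
    case (dpred_less t u)
    from T[OF this(1)] T[OF this(2)] obtain k l where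
      "\<forall>\<nu> \<nu>'. (\<forall>i<k. \<nu> i = \<nu>' i) \<longrightarrow> t \<nu> = t \<nu>'"
      "\<forall>\<nu> \<nu>'. (\<forall>i<l. \<nu> i = \<nu>' i) \<longrightarrow> u \<nu> = u \<nu>'" by blast
    then show ?case by (intro exI[of _ "max k l"]) (metis less_max_iff_disj)
  next
    case (dpred_mem t X)
    from T[OF this(1)] show ?case by metis
  next
    case (dpred_imp P Q)
    then obtain k l where
      "\<forall>\<nu> \<nu>'. (\<forall>i<k. \<nu> i = \<nu>' i) \<longrightarrow> P \<nu> = P \<nu>'"
      "\<forall>\<nu> \<nu>'. (\<forall>i<l. \<nu> i = \<nu>' i) \<longrightarrow> Q \<nu> = Q \<nu>'" by blast
    then show ?case by (intro exI[of _ "max k l"]) (metis less_max_iff_disj)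
  next
    case (dpred_ball t P)
    from T[OF this(1)] dpred_ball.IH obtain k l where k:
      "\<forall>\<nu> \<nu>'. (\<forall>i<k. \<nu> i = \<nu>' i) \<longrightarrow> t \<nu> = t \<nu>'"
      and l: "\<forall>\<nu> \<nu>'. (\<forall>i<l. \<nu> i = \<nu>' i) \<longrightarrow>
        P (\<nu> 0) (\<lambda>i. \<nu> (Suc i)) = P (\<nu>' 0) (\<lambda>i. \<nu>' (Suc i))" by blast
    have "P x \<nu> = P x \<nu>'" if "\<forall>i<max k l. \<nu> i = \<nu>' i" for x \<nu> \<nu>'
      using l[rule_format, of "case_nat x \<nu>" "case_nat x \<nu>'"] that by (simp split: nat.split)
    moreover have "t \<nu> = t \<nu>'" if "\<forall>i<max k l. \<nu> i = \<nu>' i" for \<nu> \<nu>'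
      using k that by (metis less_max_iff_disj)
    ultimately show ?case by (intro exI[of _ "max k l"]) metis
  qed simp
qed

lemma dterm_formula: "dterm f \<Longrightarrow> \<exists>t \<mu>. \<forall>\<nu>. eval M (mix \<nu> \<mu>) t = f \<nu>"
proof (induction rule: dterm.induct)
  case (dterm_var i)
  then show ?case by (intro exI[of _ "Var (2 * i)"]) simp
next
  case (dterm_const c)
  then show ?case by (intro exI[of _ "Var 1"] exI[of _ "\<lambda>_. c"]) (simp add: mix_def)
next
  case (dterm_add f g)
  then obtain t \<mu> u \<mu>' where "\<forall>\<nu>. eval M (mix \<nu> \<mu>) t = f \<nu>" "\<forall>\<nu>. eval M (mix \<nu> \<mu>') u = g \<nu>"
    by blast
  then show ?case
    by (intro exI[of _ "Add (tsub (\<lambda>i. Var (inl i)) t)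
          (tsub (\<lambda>i. Var (inr i)) u)"] exI[of _ "mix \<mu> \<mu>'"])
      (simp add: eval_tsub mix_inl mix_inr)
next
  case (dterm_mul f g)
  then obtain t \<mu> u \<mu>' where "\<forall>\<nu>. eval M (mix \<nu> \<mu>) t = f \<nu>" "\<forall>\<nu>. eval M (mix \<nu> \<mu>') u = g \<nu>"
    by blast
  then show ?case
    by (intro exI[of _ "Mul (tsub (\<lambda>i. Var (inl i)) t)
          (tsub (\<lambda>i. Var (inr i)) u)"] exI[of _ "mix \<mu> \<mu>'"])
      (simp add: eval_tsub mix_inl mix_inr)
qed

lemma dterm_formula2:
  assumes "dterm f" "dterm g"
  shows "\<exists>t u \<mu>. \<forall>\<nu>. eval M (mix \<nu> \<mu>) t = f \<nu> \<and> eval M (mix \<nu> \<mu>) u = g \<nu>"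
proof -
  obtain t \<mu> u \<mu>' where "\<forall>\<nu>. eval M (mix \<nu> \<mu>) t = f \<nu>" "\<forall>\<nu>. eval M (mix \<nu> \<mu>') u = g \<nu>"
    using dterm_formula assms by metis
  then show ?thesis
    by (intro exI[of _ "tsub (\<lambda>i. Var (inl i)) t"]
          exI[of _ "tsub (\<lambda>i. Var (inr i)) u"] exI[of _ "mix \<mu> \<mu>'"])
      (simp add: eval_tsub mix_inl mix_inr)
qed

text \<open>The way back to syntax, so that comprehension axioms apply. Parameter sequences of
  subformulas are joined by \<open>mix\<close>, with variables renamed to match.\<close>

lemma dpred_formula:
  "dpred P \<Longrightarrow> \<exists>p \<mu> \<sigma>. bounded_fm p \<and> range \<sigma> \<subseteq> m_sets M \<and> (\<forall>\<nu>. sat M (mix \<nu> \<mu>) \<sigma> p \<longleftrightarrow> P \<nu>)"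
proof (induction rule: dpred.induct)
  case (dpred_eq f g)
  obtain X where "X \<in> m_sets M" using sets_nonempty by blast
  moreover obtain t u \<mu> where "\<forall>\<nu>. eval M (mix \<nu> \<mu>) t = f \<nu> \<and> eval M (mix \<nu> \<mu>) u = g \<nu>"
    using dterm_formula2 dpred_eq by blast
  ultimately show ?case
    by (intro exI[of _ "Eq t u"] exI[of _ \<mu>] exI[of _ "\<lambda>_. X"]) (auto intro: bounded_fm.intros)
next
  case (dpred_less f g)
  obtain X where "X \<in> m_sets M" using sets_nonempty by blast
  moreover obtain t u \<mu> where "\<forall>\<nu>. eval M (mix \<nu> \<mu>) t = f \<nu> \<and> eval M (mix \<nu> \<mu>) u = g \<nu>"
    using dterm_formula2 dpred_less by blast
  ultimately show ?case
    by (intro exI[of _ "Less t u"] exI[of _ \<mu>] exI[of _ "\<lambda>_. X"]) (auto intro: bounded_fm.intros)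
next
  case (dpred_mem f X)
  obtain t \<mu> where "\<forall>\<nu>. eval M (mix \<nu> \<mu>) t = f \<nu>"
    using dterm_formula dpred_mem by blast
  then show ?case using dpred_mem
    by (intro exI[of _ "Mem t 0"] exI[of _ \<mu>] exI[of _ "\<lambda>_. X"]) (auto intro: bounded_fm.intros)
next
  case dpred_False
  obtain X where "X \<in> m_sets M" using sets_nonempty by blast
  then show ?case by (intro exI[of _ Fls] exI[of _ "\<lambda>_. X"]) (auto intro: bounded_fm.intros)
next
  case (dpred_imp P Q)
  then obtain p \<mu> \<sigma> q \<mu>' \<sigma>' where
    p: "bounded_fm p" "range \<sigma> \<subseteq> m_sets M" "\<forall>\<nu>. sat M (mix \<nu> \<mu>) \<sigma> p \<longleftrightarrow> P \<nu>" and
    q: "bounded_fm q" "range \<sigma>' \<subseteq> m_sets M" "\<forall>\<nu>. sat M (mix \<nu> \<mu>') \<sigma>' q \<longleftrightarrow> Q \<nu>" by metis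
  then show ?case
    by (intro exI[of _ "Imp (fsub (\<lambda>i. Var (inl i)) (\<lambda>i. 2 * i) p)
          (fsub (\<lambda>i. Var (inr i)) (\<lambda>i. Suc (2 * i)) q)"]
          exI[of _ "mix \<mu> \<mu>'"] exI[of _ "mix \<sigma> \<sigma>'"] conjI bounded_fm.intros bounded_fm_fsub)
      (simp_all add: sat_fsub mix_inl mix_inr range_mix)
next
  case (dpred_ball f P)
  obtain t \<mu>' where t: "\<forall>\<nu>. eval M (mix \<nu> \<mu>') t = f \<nu>"
    using dterm_formula[OF dpred_ball.hyps(1)] by metis
  obtain p \<mu> \<sigma> where
    p: "bounded_fm p" "range \<sigma> \<subseteq> m_sets M"
    "\<And>\<nu>. sat M (mix \<nu> \<mu>) \<sigma> p \<longleftrightarrow> P (\<nu> 0) (\<lambda>i. \<nu> (Suc i))" using dpred_ball.IH by metis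
  let ?t = "tsub (\<lambda>i. Var (inr i)) t"
  \<comment> \<open>Argument 0 of \<open>p\<close> becomes the bound variable and the other
    arguments move past it. Parameter j of \<open>p\<close>, at place 2 j + 1, is now the entry 2 j
    of the joint sequence, hence at place 4 j + 2 under the quantifier.\<close>
  let ?e = "\<lambda>i. if i = 0 then 0 else if even i then i - 1 else Suc (Suc (2 * (i - 1)))"
  let ?q = "fsub (\<lambda>i. Var (?e i)) id p"
  have env: "case_nat x (mix \<nu> (mix \<mu> \<mu>')) (?e i) = mix (case_nat x \<nu>) \<mu> i" for x \<nu> i
  proof (cases "even i")
    case True
    then obtain j where "i = 2 * j" by (elim evenE)
    then show ?thesis by (cases j) (simp_all add: mix_def)
  next
    case False
    then obtain j where "i = 2 * j + 1" by (elim oddE)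
    then show ?thesis using mix_odd[of \<nu> "mix \<mu> \<mu>'" "2 * j"] by simp
  qed
  have "sat M (case_nat x (mix \<nu> (mix \<mu> \<mu>'))) \<sigma> ?q \<longleftrightarrow> P x \<nu>" for x \<nu>
    using p(3)[of "case_nat x \<nu>"] by (simp only: sat_fsub eval.simps env) simp
  moreover have "eval M (mix \<nu> (mix \<mu> \<mu>')) ?t = f \<nu>" for \<nu>
    using t by (simp add: eval_tsub mix_inr)
  ultimately show ?case
    using p
    by (intro exI[of _ "AllN (Imp (Less (Var 0) (lift 1 ?t)) ?q)"]
          exI[of _ "mix \<mu> \<mu>'"] exI[of _ \<sigma>] conjI bounded_fm.intros bounded_fm_fsub)
      (simp_all add: eval_lift)
qed

lemma set_all:
  assumes "dpred (\<lambda>\<nu>. Q (\<nu> 0) (\<nu> 1))"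
  shows "{x. \<forall>y. Q y x} \<in> m_sets M"
proof -
  obtain p \<mu> \<sigma> where
    p: "bounded_fm p" "range \<sigma> \<subseteq> m_sets M" "\<And>\<nu>. sat M (mix \<nu> \<mu>) \<sigma> p \<longleftrightarrow> Q (\<nu> 0) (\<nu> 1)"
    using dpred_formula[OF assms] by metis
  \<comment> \<open>Arguments 0 and 1 sit at places 0 and 2 and go to the variables for y and x.
    Parameters move behind these two, and the remaining even places, which \<open>Q\<close> does not
    read, receive y.\<close>
  let ?e = "\<lambda>i. if odd i then Suc (Suc (i div 2)) else if i = 2 then 1 else 0"
  have env: "case_nat y (case_nat x \<mu>) (?e i) = mix (\<lambda>i. if i = 1 then x else y) \<mu> i" for x y i
  proof (cases "odd i \<or> i = 2")
    case True
    then show ?thesis by (auto simp: mix_def)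
  next
    case False
    then have "i div 2 \<noteq> 1" by presburger
    then show ?thesis using False by (simp add: mix_def)
  qed
  have "sat M (case_nat y (case_nat x \<mu>)) \<sigma> (fsub (\<lambda>i. Var (?e i)) id p) \<longleftrightarrow> Q y x" for x y
    using p(3)[of "\<lambda>i. if i = 1 then x else y"] by (simp only: sat_fsub eval.simps env) simp
  then show ?thesis
    using all_comprehension[OF bounded_fm_fsub[OF p(1), of "\<lambda>i. Var (?e i)" id] p(2), of \<mu>]
    by simp
qed

lemma set_comp:
  assumes "dpred (\<lambda>\<nu>. Q (\<nu> 0))"
  shows "{x. Q x} \<in> m_sets M"
  using set_all[of "\<lambda>y x. Q x"] dpred_subst[OF assms, of "\<lambda>i \<nu>. \<nu> (Suc i)"]
  by (simp add: dterm.intros)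

lemma set_induct:
  assumes "X \<in> m_sets M" "\<zero> \<in> X" "\<And>x. x \<in> X \<Longrightarrow> x \<oplus> \<one> \<in> X"
  shows "x \<in> X"
proof -
  \<comment> \<open>A dummy quantifier gives the formula the shape required for induction; under it
    the induction variable has index 1.\<close>
  let ?p = "ExN (Mem (Var 1) 0)"
  have "?p \<in> Sigma_fm 0 1" by (auto intro: bounded_fm.intros)
  then have "valid M (induction_ax ?p)" by (rule induction)
  then have "sat M (\<lambda>_. x) (\<lambda>_. X) (induction_ax ?p)"
    using assms(1) by (auto simp: valid_def)
  moreover have "sat M (\<lambda>_. x) (\<lambda>_. X) (induction_ax ?p) \<longleftrightarrow>
      (\<zero> \<in> X \<and> (\<forall>x. x \<in> X \<longrightarrow> x \<oplus> \<one> \<in> X) \<longrightarrow> (\<forall>x. x \<in> X))"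
    unfolding induction_ax_def sat.simps sat_instN sat_fsub by simp
  ultimately show ?thesis using assms(2,3) by blast
qed

text \<open>Definable properties are sets of the model, so induction for sets covers them all,
  whatever their quantifier complexity.\<close>

lemma induct:
  assumes "dpred (\<lambda>\<nu>. P (\<nu> 0))" "P \<zero>" "\<And>x. P x \<Longrightarrow> P (x \<oplus> \<one>)"
  shows "P x"
  using set_induct[OF set_comp[OF assms(1)], of x] assms(2,3) by simp

end


section \<open>Arithmetic in a model\<close>

context ca_model
begin

lemma basic_sat: "p \<in> basic_axioms \<Longrightarrow> \<exists>\<sigma>. sat M \<nu> \<sigma> p"
proof -
  assume "p \<in> basic_axioms"
  moreover obtain X where "X \<in> m_sets M" using sets_nonempty by blast
  then have "range (\<lambda>_ :: nat. X) \<subseteq> m_sets M" by blast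
  ultimately show ?thesis using basic unfolding valid_def by blast
qed

lemma basic_axioms_sat:
  "x \<oplus> \<one> \<noteq> \<zero>"
  "x \<oplus> \<one> = y \<oplus> \<one> \<Longrightarrow> x = y"
  "x \<oplus> \<zero> = x"
  "x \<oplus> (y \<oplus> \<one>) = (x \<oplus> y) \<oplus> \<one>"
  "x \<otimes> \<zero> = \<zero>"
  "x \<otimes> (y \<oplus> \<one>) = x \<otimes> y \<oplus> x"
  "\<not> x \<prec> \<zero>"
  "x \<prec> y \<oplus> \<one> \<longleftrightarrow> x \<prec> y \<or> x = y"
proof -
  let ?\<nu> = "\<lambda>i. if i = 0 then y else x"
  note b1 = basic_sat[of _ "\<lambda>_. x"] and b2 = basic_sat[of _ ?\<nu>]
  show "x \<oplus> \<one> \<noteq> \<zero>"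
    using b1[of "Neg (Eq (Add (Var 0) One) Zero)"] by (simp add: basic_axioms_def Let_def)
  show "x \<oplus> \<one> = y \<oplus> \<one> \<Longrightarrow> x = y"
    using b2[of "Imp (Eq (Add (Var 1) One) (Add (Var 0) One)) (Eq (Var 1) (Var 0))"]
    by (simp add: basic_axioms_def Let_def)
  show "x \<oplus> \<zero> = x"
    using b1[of "Eq (Add (Var 0) Zero) (Var 0)"] by (simp add: basic_axioms_def Let_def)
  show "x \<oplus> (y \<oplus> \<one>) = (x \<oplus> y) \<oplus> \<one>"
    using b2[of "Eq (Add (Var 1) (Add (Var 0) One)) (Add (Add (Var 1) (Var 0)) One)"]
    by (simp add: basic_axioms_def Let_def)
  show "x \<otimes> \<zero> = \<zero>"
    using b1[of "Eq (Mul (Var 0) Zero) Zero"] by (simp add: basic_axioms_def Let_def)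
  show "x \<otimes> (y \<oplus> \<one>) = x \<otimes> y \<oplus> x"
    using b2[of "Eq (Mul (Var 1) (Add (Var 0) One)) (Add (Mul (Var 1) (Var 0)) (Var 1))"]
    by (simp add: basic_axioms_def Let_def)
  show "\<not> x \<prec> \<zero>"
    using b1[of "Neg (Less (Var 0) Zero)"] by (simp add: basic_axioms_def Let_def)
  show "x \<prec> y \<oplus> \<one> \<longleftrightarrow> x \<prec> y \<or> x = y"
    using b2[of "Iff (Less (Var 1) (Add (Var 0) One)) (Or (Less (Var 1) (Var 0)) (Eq (Var 1) (Var 0)))"]
    by (simp add: basic_axioms_def Let_def) blast
qed

lemmas succ_neq_zero [simp] = basic_axioms_sat(1)
lemmas succ_inject = basic_axioms_sat(2)
lemmas add_zero [simp] = basic_axioms_sat(3)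
lemmas add_succ = basic_axioms_sat(4)
lemmas mul_zero [simp] = basic_axioms_sat(5)
lemmas mul_succ = basic_axioms_sat(6)
lemmas not_less_zero [simp] = basic_axioms_sat(7)
lemmas less_succ = basic_axioms_sat(8)

section \<open>Commutative semiring laws\<close>

lemma add_assoc: "a \<oplus> b \<oplus> c = a \<oplus> (b \<oplus> c)"
proof (rule induct[of "\<lambda>c. a \<oplus> b \<oplus> c = a \<oplus> (b \<oplus> c)" c])
  show "dpred (\<lambda>\<nu>. a \<oplus> b \<oplus> \<nu> 0 = a \<oplus> (b \<oplus> \<nu> 0))" by (intro dintros)
  show "a \<oplus> b \<oplus> (x \<oplus> \<one>) = a \<oplus> (b \<oplus> (x \<oplus> \<one>))" if "a \<oplus> b \<oplus> x = a \<oplus> (b \<oplus> x)" for x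
    using that by (simp add: add_succ)
qed simp

lemma zero_add [simp]: "\<zero> \<oplus> a = a"
proof (rule induct[of "\<lambda>a. \<zero> \<oplus> a = a" a])
  show "dpred (\<lambda>\<nu>. \<zero> \<oplus> \<nu> 0 = \<nu> 0)" by (intro dintros)
qed (simp_all add: add_succ)

lemma one_add: "\<one> \<oplus> a = a \<oplus> \<one>"
proof (rule induct[of "\<lambda>a. \<one> \<oplus> a = a \<oplus> \<one>" a])
  show "dpred (\<lambda>\<nu>. \<one> \<oplus> \<nu> 0 = \<nu> 0 \<oplus> \<one>)" by (intro dintros)
qed (simp_all add: add_succ)

lemma add_commute: "a \<oplus> b = b \<oplus> a"
proof (rule induct[of "\<lambda>b. a \<oplus> b = b \<oplus> a" b])
  show "dpred (\<lambda>\<nu>. a \<oplus> \<nu> 0 = \<nu> 0 \<oplus> a)" by (intro dintros)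
  show "a \<oplus> (x \<oplus> \<one>) = (x \<oplus> \<one>) \<oplus> a" if "a \<oplus> x = x \<oplus> a" for x
    using that by (metis add_assoc one_add)
qed simp

lemma add_left_commute: "a \<oplus> (b \<oplus> c) = b \<oplus> (a \<oplus> c)"
  by (metis add_assoc add_commute)

lemmas add_ac = add_assoc add_commute add_left_commute

lemma zero_mul [simp]: "\<zero> \<otimes> a = \<zero>"
proof (rule induct[of "\<lambda>a. \<zero> \<otimes> a = \<zero>" a])
  show "dpred (\<lambda>\<nu>. \<zero> \<otimes> \<nu> 0 = \<zero>)" by (intro dintros)
qed (simp_all add: mul_succ)

lemma succ_mul: "(a \<oplus> \<one>) \<otimes> b = a \<otimes> b \<oplus> b"
proof (rule induct[of "\<lambda>b. (a \<oplus> \<one>) \<otimes> b = a \<otimes> b \<oplus> b" b])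
  show "dpred (\<lambda>\<nu>. (a \<oplus> \<one>) \<otimes> \<nu> 0 = a \<otimes> \<nu> 0 \<oplus> \<nu> 0)" by (intro dintros)
qed (simp_all add: mul_succ add_ac)

lemma mul_commute: "a \<otimes> b = b \<otimes> a"
proof (rule induct[of "\<lambda>b. a \<otimes> b = b \<otimes> a" b])
  show "dpred (\<lambda>\<nu>. a \<otimes> \<nu> 0 = \<nu> 0 \<otimes> a)" by (intro dintros)
qed (simp_all add: mul_succ succ_mul)

lemma distrib_left: "a \<otimes> (b \<oplus> c) = a \<otimes> b \<oplus> a \<otimes> c"
proof (rule induct[of "\<lambda>c. a \<otimes> (b \<oplus> c) = a \<otimes> b \<oplus> a \<otimes> c" c])
  show "dpred (\<lambda>\<nu>. a \<otimes> (b \<oplus> \<nu> 0) = a \<otimes> b \<oplus> a \<otimes> \<nu> 0)" by (intro dintros)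
  show "a \<otimes> (b \<oplus> (x \<oplus> \<one>)) = a \<otimes> b \<oplus> a \<otimes> (x \<oplus> \<one>)" if "a \<otimes> (b \<oplus> x) = a \<otimes> b \<oplus> a \<otimes> x" for x
    using that by (metis add_assoc mul_succ)
qed simp

lemma distrib_right: "(b \<oplus> c) \<otimes> a = b \<otimes> a \<oplus> c \<otimes> a"
  by (metis distrib_left mul_commute)

lemma mul_one [simp]: "a \<otimes> \<one> = a"
  using mul_succ[of a \<zero>] by simp

lemma mul_assoc: "a \<otimes> b \<otimes> c = a \<otimes> (b \<otimes> c)"
proof (rule induct[of "\<lambda>c. a \<otimes> b \<otimes> c = a \<otimes> (b \<otimes> c)" c])
  show "dpred (\<lambda>\<nu>. a \<otimes> b \<otimes> \<nu> 0 = a \<otimes> (b \<otimes> \<nu> 0))" by (intro dintros)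
qed (simp_all add: mul_succ distrib_left)

lemma mul_left_commute: "a \<otimes> (b \<otimes> c) = b \<otimes> (a \<otimes> c)"
  by (metis mul_assoc mul_commute)

lemmas mul_ac = mul_assoc mul_commute mul_left_commute

lemmas ring_laws = add_ac mul_ac distrib_left distrib_right

lemma add_right_cancel [simp]: "a \<oplus> c = b \<oplus> c \<longleftrightarrow> a = b"
proof -
  have "a \<oplus> c = b \<oplus> c \<longrightarrow> a = b"
  proof (rule induct[of "\<lambda>c. a \<oplus> c = b \<oplus> c \<longrightarrow> a = b" c])
    show "dpred (\<lambda>\<nu>. a \<oplus> \<nu> 0 = b \<oplus> \<nu> 0 \<longrightarrow> a = b)" by (intro dintros)
    show "a \<oplus> (x \<oplus> \<one>) = b \<oplus> (x \<oplus> \<one>) \<longrightarrow> a = b" if "a \<oplus> x = b \<oplus> x \<longrightarrow> a = b" for x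
      using that by (metis add_succ succ_inject)
  qed simp
  then show ?thesis by blast
qed

lemma add_left_cancel [simp]: "c \<oplus> a = c \<oplus> b \<longleftrightarrow> a = b"
  by (metis add_commute add_right_cancel)

section \<open>Predecessors and the order\<close>

lemma zero_or_succ: "a = \<zero> \<or> (\<exists>b. a = b \<oplus> \<one>)"
proof -
  \<comment> \<open>The witness is sought below \<open>a\<close> because only bounded quantifiers
    are known to preserve definability at this point.\<close>
  have "a = \<zero> \<or> (\<exists>b. b \<prec> a \<and> a = b \<oplus> \<one>)"
  proof (rule induct[of "\<lambda>a. a = \<zero> \<or> (\<exists>b. b \<prec> a \<and> a = b \<oplus> \<one>)" a])
    show "dpred (\<lambda>\<nu>. \<nu> 0 = \<zero> \<or> (\<exists>b. b \<prec> \<nu> 0 \<and> \<nu> 0 = b \<oplus> \<one>))"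
      by (intro dintros dpred_bex)
  qed (auto simp: less_succ)
  then show ?thesis by blast
qed

lemma add_eq_zero [simp]: "a \<oplus> b = \<zero> \<longleftrightarrow> a = \<zero> \<and> b = \<zero>"
  using zero_or_succ[of b] by (auto simp: add_succ)

lemma succ_less_mono: "a \<prec> b \<longrightarrow> a \<oplus> \<one> \<prec> b \<oplus> \<one>"
proof (rule induct[of "\<lambda>b. a \<prec> b \<longrightarrow> a \<oplus> \<one> \<prec> b \<oplus> \<one>" b])
  show "dpred (\<lambda>\<nu>. a \<prec> \<nu> 0 \<longrightarrow> a \<oplus> \<one> \<prec> \<nu> 0 \<oplus> \<one>)" by (intro dintros)
qed (auto simp: less_succ)

lemma zero_less_succ [simp]: "\<zero> \<prec> a \<oplus> \<one>"
proof (rule induct[of "\<lambda>a. \<zero> \<prec> a \<oplus> \<one>" a])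
  show "dpred (\<lambda>\<nu>. \<zero> \<prec> \<nu> 0 \<oplus> \<one>)" by (intro dintros)
  show "\<zero> \<prec> \<zero> \<oplus> \<one>" unfolding less_succ by blast
qed (auto simp: less_succ)

lemma less_add_succ: "a \<prec> a \<oplus> (b \<oplus> \<one>)"
proof (rule induct[of "\<lambda>b. a \<prec> a \<oplus> (b \<oplus> \<one>)" b])
  show "dpred (\<lambda>\<nu>. a \<prec> a \<oplus> (\<nu> 0 \<oplus> \<one>))" by (intro dintros)
qed (auto simp: less_succ add_succ)

lemma less_iff_add: "a \<prec> b \<longleftrightarrow> (\<exists>c. b = a \<oplus> (c \<oplus> \<one>))"
proof
  have "a \<prec> b \<longrightarrow> (\<exists>c. c \<prec> b \<and> b = a \<oplus> (c \<oplus> \<one>))"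
  proof (rule induct[of "\<lambda>b. a \<prec> b \<longrightarrow> (\<exists>c. c \<prec> b \<and> b = a \<oplus> (c \<oplus> \<one>))" b])
    show "dpred (\<lambda>\<nu>. a \<prec> \<nu> 0 \<longrightarrow> (\<exists>c. c \<prec> \<nu> 0 \<and> \<nu> 0 = a \<oplus> (c \<oplus> \<one>)))"
      by (intro dintros dpred_bex)
    fix x
    assume IH: "a \<prec> x \<longrightarrow> (\<exists>c. c \<prec> x \<and> x = a \<oplus> (c \<oplus> \<one>))"
    show "a \<prec> x \<oplus> \<one> \<longrightarrow> (\<exists>c. c \<prec> x \<oplus> \<one> \<and> x \<oplus> \<one> = a \<oplus> (c \<oplus> \<one>))"
    proof
      assume "a \<prec> x \<oplus> \<one>"
      then consider "a \<prec> x" | "a = x" by (auto simp: less_succ)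
      then show "\<exists>c. c \<prec> x \<oplus> \<one> \<and> x \<oplus> \<one> = a \<oplus> (c \<oplus> \<one>)"
      proof cases
        case 1
        then obtain c where c: "c \<prec> x" "x = a \<oplus> (c \<oplus> \<one>)" using IH by blast
        then have "c \<oplus> \<one> \<prec> x \<oplus> \<one>" using succ_less_mono by blast
        moreover have "x \<oplus> \<one> = a \<oplus> ((c \<oplus> \<one>) \<oplus> \<one>)" using c(2) by (simp only: add_succ)
        ultimately show ?thesis by blast
      next
        case 2
        then show ?thesis by (intro exI[of _ \<zero>]) simp
      qed
    qed
  qed simp
  then show "a \<prec> b \<Longrightarrow> \<exists>c. b = a \<oplus> (c \<oplus> \<one>)" by blast
qed (auto intro: less_add_succ)

lemma less_irrefl [simp]: "\<not> a \<prec> a"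
proof
  assume "a \<prec> a"
  then obtain c where "a \<oplus> \<zero> = a \<oplus> (c \<oplus> \<one>)" unfolding less_iff_add by auto
  then show False unfolding add_left_cancel by (metis succ_neq_zero)
qed

lemma less_trans: "a \<prec> b \<Longrightarrow> b \<prec> c \<Longrightarrow> a \<prec> c"
  unfolding less_iff_add by (metis add_assoc)

lemma less_not_sym: "a \<prec> b \<Longrightarrow> \<not> b \<prec> a"
  using less_trans less_irrefl by blast

lemma less_linear: "a \<prec> b \<or> a = b \<or> b \<prec> a"
proof (rule induct[of "\<lambda>a. a \<prec> b \<or> a = b \<or> b \<prec> a" a])
  show "dpred (\<lambda>\<nu>. \<nu> 0 \<prec> b \<or> \<nu> 0 = b \<or> b \<prec> \<nu> 0)" by (intro dintros)
  show "\<zero> \<prec> b \<or> \<zero> = b \<or> b \<prec> \<zero>" using zero_or_succ[of b] zero_less_succ by blast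
  fix x
  assume "x \<prec> b \<or> x = b \<or> b \<prec> x"
  then consider "x \<prec> b" | "b \<prec> x \<oplus> \<one>" by (auto simp: less_succ)
  then show "x \<oplus> \<one> \<prec> b \<or> x \<oplus> \<one> = b \<or> b \<prec> x \<oplus> \<one>"
  proof cases
    case 1
    then show ?thesis using succ_less_mono[of x b] less_succ by blast
  qed blast
qed

definition le (infix "\<preceq>" 50) where "a \<preceq> b \<longleftrightarrow> (\<exists>c. b = a \<oplus> c)"

lemma le_iff_less_succ: "a \<preceq> b \<longleftrightarrow> a \<prec> b \<oplus> \<one>"
  unfolding le_def less_iff_add by (metis add_assoc succ_inject)

lemma le_iff: "a \<preceq> b \<longleftrightarrow> a \<prec> b \<or> a = b"
  by (simp add: le_iff_less_succ less_succ)

lemma not_less: "\<not> a \<prec> b \<longleftrightarrow> b \<preceq> a"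
  using less_linear less_not_sym less_irrefl le_iff by metis

lemma le_less_trans: "a \<preceq> b \<Longrightarrow> b \<prec> c \<Longrightarrow> a \<prec> c"
  unfolding le_iff using less_trans by blast

lemma less_le_trans: "a \<prec> b \<Longrightarrow> b \<preceq> c \<Longrightarrow> a \<prec> c"
  unfolding le_iff using less_trans by blast

lemma le_trans: "a \<preceq> b \<Longrightarrow> b \<preceq> c \<Longrightarrow> a \<preceq> c"
  unfolding le_iff using less_trans by blast

lemma le_add1: "a \<preceq> a \<oplus> b" and le_add2: "a \<preceq> b \<oplus> a"
  unfolding le_def using add_commute by blast+

section \<open>The pairing function and unbounded quantification\<close>

definition pair where "pair i j = (i \<oplus> j) \<otimes> (i \<oplus> j) \<oplus> i"

lemma mul_eq_zero: "a \<otimes> b = \<zero> \<Longrightarrow> a = \<zero> \<or> b = \<zero>"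
  using zero_or_succ[of a] zero_or_succ[of b] by (auto simp: mul_succ)

lemma le_square: "a \<preceq> a \<otimes> a"
  using zero_or_succ[of a] le_add2 by (metis mul_succ mul_zero add_zero le_def)

lemma le_pair1: "i \<preceq> pair i j" and le_pair2: "j \<preceq> pair i j"
proof -
  show "i \<preceq> pair i j" unfolding pair_def by (rule le_add2)
  have "j \<preceq> i \<oplus> j" by (rule le_add2)
  also have "i \<oplus> j \<preceq> (i \<oplus> j) \<otimes> (i \<oplus> j)" by (rule le_square)
  finally (le_trans) show "j \<preceq> pair i j" unfolding pair_def using le_add1 le_trans by blast
qed

text \<open>With s = i + j one has i \<le> s, so the pair lies below the square of s + 1. A larger
  sum therefore forces a larger code.\<close>

lemma pair_sum_not_less:
  assumes "pair i j = pair i' j'"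
  shows "\<not> i \<oplus> j \<prec> i' \<oplus> j'"
proof
  assume "i \<oplus> j \<prec> i' \<oplus> j'"
  then obtain z where z: "i' \<oplus> j' = i \<oplus> j \<oplus> (z \<oplus> \<one>)" unfolding less_iff_add by blast
  define s where "s = i \<oplus> j"
  have "pair i' j' = (s \<oplus> (z \<oplus> \<one>)) \<otimes> (s \<oplus> (z \<oplus> \<one>)) \<oplus> i'"
    unfolding pair_def z s_def ..
  also have "\<dots> = s \<otimes> s \<oplus> (i \<oplus> (\<one> \<oplus> (j \<oplus> s \<oplus> s \<otimes> z \<oplus> s \<otimes> z \<oplus> z \<otimes> z \<oplus> z \<oplus> z \<oplus> i')))"
    by (simp add: ring_laws s_def)
  finally have "s \<otimes> s \<oplus> (i \<oplus> \<zero>) = s \<otimes> s \<oplus> (i \<oplus> (\<one> \<oplus> (j \<oplus> s \<oplus> s \<otimes> z \<oplus> s \<otimes> z \<oplus> z \<otimes> z \<oplus> z \<oplus> z \<oplus> i')))"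
    using assms by (simp add: pair_def s_def)
  then show False unfolding add_left_cancel by (metis add_commute succ_neq_zero)
qed

lemma pair_inject [simp]: "pair i j = pair i' j' \<longleftrightarrow> i = i' \<and> j = j'"
proof
  assume e: "pair i j = pair i' j'"
  then have "i \<oplus> j = i' \<oplus> j'"
    using pair_sum_not_less[of i j i' j'] pair_sum_not_less[of i' j' i j] less_linear by metis
  moreover from this have "i = i'" using e unfolding pair_def by simp
  ultimately show "i = i' \<and> j = j'" by simp
qed simp

lemma dterm_pair: "dterm t \<Longrightarrow> dterm u \<Longrightarrow> dterm (\<lambda>\<nu>. pair (t \<nu>) (u \<nu>))"
  unfolding pair_def by (intro dterm.intros)

text \<open>Unbounded quantification over \<open>P\<close> gives a set when \<open>P\<close> has one parameter; further
  parameters are merged into one by pairing.\<close>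

lemma dpred_all_support:
  assumes "dpred P" "\<And>\<nu> \<nu>'. (\<forall>i<k. \<nu> i = \<nu>' i) \<Longrightarrow> P \<nu> = P \<nu>'"
  shows "dpred (\<lambda>\<nu>. \<forall>x. P (case_nat x \<nu>))"
  using assms
proof (induction k arbitrary: P)
  case (Suc k)
  show ?case
  proof (cases "k \<le> 1")
    case True
    \<comment> \<open>With at most one parameter the universal statement defines a set of the model,
      and membership in that set is atomic.\<close>
    have "dpred (\<lambda>\<nu>. P (\<lambda>i. (case i of 0 \<Rightarrow> \<lambda>\<nu>. \<nu> 0 | Suc _ \<Rightarrow> \<lambda>\<nu>. \<nu> 1) \<nu>))"
      by (rule dpred_subst[OF Suc.prems(1)]) (auto intro: dterm.intros split: nat.split)
    moreover have "(\<lambda>i. (case i of 0 \<Rightarrow> \<lambda>\<nu>. \<nu> 0 | Suc _ \<Rightarrow> \<lambda>\<nu>. \<nu> 1) \<nu>) = case_nat (\<nu> 0) (\<lambda>_. \<nu> 1)"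
      for \<nu> :: "nat \<Rightarrow> 'a" by (rule ext) (simp split: nat.split)
    ultimately have "{x. \<forall>y. P (case_nat y (\<lambda>_. x))} \<in> m_sets M"
      using set_all[of "\<lambda>y x. P (case_nat y (\<lambda>_. x))"] by simp
    then have "dpred (\<lambda>\<nu>. \<nu> 0 \<in> {x. \<forall>y. P (case_nat y (\<lambda>_. x))})"
      by (intro dintros)
    moreover have "P (case_nat y (\<lambda>_. \<nu> 0)) = P (case_nat y \<nu>)" for y \<nu>
    proof (rule Suc.prems(2), intro allI impI)
      fix i
      assume "i < Suc k"
      then have "i = 0 \<or> i = 1" using True by linarith
      then show "case_nat y (\<lambda>_. \<nu> 0) i = case_nat y \<nu> i" by auto
    qed
    ultimately show ?thesis by simp
  next
    case False
    \<comment> \<open>\<open>P'\<close> reads parameters 1 and 2 of \<open>P\<close> off one pair at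
      index 1. Both components are bounded by the pair, so bounded quantifiers suffice, and the
      support shrinks from \<open>Suc k\<close> to \<open>k\<close>.\<close>
    define P' where "P' \<nu> \<longleftrightarrow> (\<exists>a. a \<prec> \<nu> 1 \<oplus> \<one> \<and> (\<exists>b. b \<prec> \<nu> 1 \<oplus> \<one> \<and> (\<nu> 1 = pair a b \<and>
      P (case_nat (\<nu> 0) (case_nat a (case_nat b (\<lambda>i. \<nu> (Suc (Suc i)))))))))" for \<nu>
    let ?e = "case_nat (Suc (Suc 0)) (case_nat (Suc 0) (case_nat 0 (\<lambda>i. Suc (Suc (Suc (Suc i))))))"
    have "dpred (\<lambda>\<nu>. P (\<lambda>i. \<nu> (?e i)))"
      by (rule dpred_subst[OF Suc.prems(1)]) (rule dterm_var)
    moreover have "(\<lambda>i. \<nu> (?e i)) = case_nat (\<nu> (Suc (Suc 0))) (case_nat (\<nu> (Suc 0))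
        (case_nat (\<nu> 0) (\<lambda>i. \<nu> (Suc (Suc (Suc (Suc i)))))))" for \<nu> :: "nat \<Rightarrow> 'a"
      by (rule ext) (simp split: nat.split)
    ultimately have body: "dpred (\<lambda>\<nu>. P (case_nat (\<nu> (Suc (Suc 0))) (case_nat (\<nu> (Suc 0))
        (case_nat (\<nu> 0) (\<lambda>i. \<nu> (Suc (Suc (Suc (Suc i)))))))))"
      by (simp only:)
    have "dpred P'"
      unfolding P'_def by (intro dpred_bex dintros dterm_pair) (rule body)
    moreover have "P' \<nu> = P' \<nu>'" if "\<forall>i<k. \<nu> i = \<nu>' i" for \<nu> \<nu>'
    proof -
      have "\<nu> 1 = \<nu>' 1" using that False by simp
      moreover have "P (case_nat (\<nu> 0) (case_nat a (case_nat b (\<lambda>i. \<nu> (Suc (Suc i)))))) =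
          P (case_nat (\<nu>' 0) (case_nat a (case_nat b (\<lambda>i. \<nu>' (Suc (Suc i))))))" for a b
        by (rule Suc.prems(2)) (use that False in \<open>auto split: nat.split\<close>)
      ultimately show ?thesis by (simp add: P'_def)
    qed
    ultimately have "dpred (\<lambda>\<nu>. \<forall>x. P' (case_nat x \<nu>))" by (rule Suc.IH)
    then have "dpred (\<lambda>\<nu>. \<forall>x. P' (case_nat x (\<lambda>i. case_nat (pair (\<nu> 0) (\<nu> 1)) (\<lambda>i. \<nu> (Suc (Suc i))) i)))"
    proof (rule dpred_subst)
      show "dterm (\<lambda>\<nu>. case_nat (pair (\<nu> 0) (\<nu> 1)) (\<lambda>i. \<nu> (Suc (Suc i))) i)" for i
        by (cases i) (auto intro: dterm.intros dterm_pair)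
    qed
    moreover have "P' (case_nat x (\<lambda>i. case_nat (pair (\<nu> 0) (\<nu> 1)) (\<lambda>i. \<nu> (Suc (Suc i))) i)) = P (case_nat x \<nu>)"
      for x \<nu>
    proof -
      have "case_nat (\<nu> 0) (case_nat (\<nu> 1) (\<lambda>i. \<nu> (Suc (Suc i)))) = \<nu>"
        by (rule ext) (simp split: nat.split)
      then show ?thesis
        using le_pair1[of "\<nu> 0" "\<nu> 1"] le_pair2[of "\<nu> 1" "\<nu> 0"]
        by (auto simp: P'_def le_iff_less_succ)
    qed
    ultimately show ?thesis by simp
  qed
next
  case 0
  have "\<exists>b. \<forall>\<nu>. P \<nu> = b"
    using 0(2)[of _ "\<lambda>_. \<zero>"] by (intro exI[of _ "P (\<lambda>_. \<zero>)"]) auto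
  then obtain b where "\<And>\<nu>. P \<nu> = b" by blast
  then show ?case by (simp add: dpred_const)
qed

lemma dpred_all:
  assumes "dpred (\<lambda>\<nu>. P (\<nu> 0) (\<lambda>i. \<nu> (Suc i)))"
  shows "dpred (\<lambda>\<nu>. \<forall>x. P x \<nu>)"
proof -
  obtain k where "\<forall>\<nu> \<nu>'. (\<forall>i<k. \<nu> i = \<nu>' i) \<longrightarrow>
      P (\<nu> 0) (\<lambda>i. \<nu> (Suc i)) = P (\<nu>' 0) (\<lambda>i. \<nu>' (Suc i))"
    using dpred_support[OF assms] by blast
  then have "dpred (\<lambda>\<nu>. \<forall>x. P (case_nat x \<nu> 0) (\<lambda>i. case_nat x \<nu> (Suc i)))"
    using dpred_all_support[OF assms, of k] by blast
  then show ?thesis by simp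
qed

lemma dpred_ex: "dpred (\<lambda>\<nu>. P (\<nu> 0) (\<lambda>i. \<nu> (Suc i))) \<Longrightarrow> dpred (\<lambda>\<nu>. \<exists>x. P x \<nu>)"
  using dpred_not[OF dpred_all[OF dpred_not]] by simp

text \<open>Here comprehension for one number quantifier becomes arithmetical comprehension: every
  quantifier of the formula is absorbed by \<open>dpred_all\<close>.\<close>

lemma sat_arithmetical:
  assumes "arithmetical p" "range \<sigma> \<subseteq> m_sets M"
  shows "dpred (\<lambda>\<nu>. sat M \<nu> \<sigma> p)"
proof -
  have T: "dterm (\<lambda>\<nu>. eval M \<nu> t)" for t
    by (induction t) (auto intro: dterm.intros)
  show ?thesis
    using assms(1)
  proof (induction p)
    case (Mem t X)
    have "\<sigma> X \<in> m_sets M" using assms(2) by blast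
    then show ?case using T by (simp add: dpred_mem)
  next
    case (AllN p)
    have "case_nat (\<nu> 0) (\<lambda>i. \<nu> (Suc i)) = \<nu>" for \<nu> :: "nat \<Rightarrow> 'a"
      by (rule ext) (simp split: nat.split)
    then show ?case using AllN by (simp add: dpred_all)
  qed (simp_all add: T dintros)
qed

end


section \<open>Coding bounded sets\<close>

context ca_model
begin

lemma one_neq_zero [simp]: "\<one> \<noteq> \<zero>"
  using succ_neq_zero[of \<zero>] by simp

lemmas dquants = dpred_all dpred_ex dterm_pair

lemma dpred_subst2:
  assumes "dpred (\<lambda>\<nu>. Q (\<nu> 0) (\<nu> 1))" "dterm t" "dterm u"
  shows "dpred (\<lambda>\<nu>. Q (t \<nu>) (u \<nu>))"
proof -
  have "dterm ((case i of 0 \<Rightarrow> t | Suc _ \<Rightarrow> u))" for i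
    using assms(2,3) by (simp split: nat.split)
  then show ?thesis
    using dpred_subst[OF assms(1), of "\<lambda>i. case i of 0 \<Rightarrow> t | Suc _ \<Rightarrow> u"] by simp
qed

section \<open>Divisibility and the moduli of the beta function\<close>

definition divides (infix "\<bar>\<bar>" 50) where "a \<bar>\<bar> b \<longleftrightarrow> (\<exists>c. b = a \<otimes> c)"

lemma dpred_divides: "dterm t \<Longrightarrow> dterm u \<Longrightarrow> dpred (\<lambda>\<nu>. t \<nu> \<bar>\<bar> u \<nu>)"
proof (rule dpred_subst2)
  show "dpred (\<lambda>\<nu>. \<nu> 0 \<bar>\<bar> \<nu> 1)" unfolding divides_def by (intro dquants dintros)
qed

lemma divides_mult: "a \<bar>\<bar> b \<Longrightarrow> a \<bar>\<bar> b \<otimes> c" "a \<bar>\<bar> b \<Longrightarrow> a \<bar>\<bar> c \<otimes> b"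
  unfolding divides_def by (metis mul_assoc, metis mul_assoc mul_commute)

lemma divides_refl: "a \<bar>\<bar> a"
  unfolding divides_def by (metis mul_one)

text \<open>Subtraction is missing, so the two quotients are compared first: if the quotient of the
  sum were the smaller one, a nonzero product would vanish.\<close>

lemma divides_add_cancel:
  assumes "d \<bar>\<bar> a \<oplus> b" "d \<bar>\<bar> a" "d \<noteq> \<zero>"
  shows "d \<bar>\<bar> b"
proof -
  obtain u v where u: "a \<oplus> b = d \<otimes> u" and v: "a = d \<otimes> v"
    using assms unfolding divides_def by blast
  have "\<not> u \<prec> v"
  proof
    assume "u \<prec> v"
    then obtain w where "v = u \<oplus> (w \<oplus> \<one>)" unfolding less_iff_add by blast
    then have "d \<otimes> u \<oplus> (d \<otimes> (w \<oplus> \<one>) \<oplus> b) = d \<otimes> u \<oplus> \<zero>"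
      using u v by (simp add: distrib_left add_assoc)
    then show False unfolding add_left_cancel using mul_eq_zero[of d "w \<oplus> \<one>"] assms(3) by auto
  qed
  then obtain w where "u = v \<oplus> w" unfolding not_less le_def by blast
  then have "a \<oplus> b = a \<oplus> d \<otimes> w" using u v by (simp add: distrib_left)
  then show ?thesis unfolding add_left_cancel divides_def by blast
qed

text \<open>Write d for the modulus at y. The two moduli differ by m \<delta>, so d divides n m
  \<delta>. Modulo d the product m (y + 1) is -1, hence m can be cancelled and d divides n \<delta>.
  As \<delta> divides m, d divides n m (y + 1), and the same cancellation gives n. Neither gcd nor
  primes are needed.\<close>

lemma beta_coprime:
  assumes dvd: "m \<otimes> (y \<oplus> \<one>) \<oplus> \<one> \<bar>\<bar> n \<otimes> (m \<otimes> (j \<oplus> \<one>) \<oplus> \<one>)"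
    and \<delta>: "\<delta> \<bar>\<bar> m" "j = y \<oplus> \<delta> \<or> y = j \<oplus> \<delta>"
  shows "m \<otimes> (y \<oplus> \<one>) \<oplus> \<one> \<bar>\<bar> n"
proof -
  let ?d = "m \<otimes> (y \<oplus> \<one>) \<oplus> \<one>" and ?c = "m \<otimes> (j \<oplus> \<one>) \<oplus> \<one>"
  have d: "?d \<noteq> \<zero>" by simp
  have 1: "?d \<bar>\<bar> n \<otimes> (m \<otimes> \<delta>)"
    using \<delta>(2)
  proof
    assume "j = y \<oplus> \<delta>"
    then have "n \<otimes> ?c = n \<otimes> ?d \<oplus> n \<otimes> (m \<otimes> \<delta>)" by (simp add: ring_laws)
    then show ?thesis
      using divides_add_cancel[OF _ divides_mult(2)[OF divides_refl] d] dvd by metis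
  next
    assume "y = j \<oplus> \<delta>"
    then have "n \<otimes> ?d = n \<otimes> ?c \<oplus> n \<otimes> (m \<otimes> \<delta>)" by (simp add: ring_laws)
    then show ?thesis
      using divides_add_cancel[OF _ dvd d] divides_mult(2)[OF divides_refl] by metis
  qed
  have 2: "?d \<bar>\<bar> x" if "?d \<bar>\<bar> x \<otimes> (m \<otimes> (y \<oplus> \<one>))" for x
  proof -
    have "x \<otimes> ?d = x \<otimes> (m \<otimes> (y \<oplus> \<one>)) \<oplus> x" by (simp add: distrib_left)
    then show ?thesis
      using divides_add_cancel[OF _ that d] divides_mult(2)[OF divides_refl] by metis
  qed
  have "n \<otimes> (m \<otimes> \<delta>) \<otimes> (y \<oplus> \<one>) = (n \<otimes> \<delta>) \<otimes> (m \<otimes> (y \<oplus> \<one>))" by (simp only: mul_ac)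
  then have "?d \<bar>\<bar> n \<otimes> \<delta>" using 2 divides_mult(1)[OF 1] by metis
  moreover obtain m' where "m = \<delta> \<otimes> m'" using \<delta>(1) unfolding divides_def by blast
  then have "n \<otimes> \<delta> \<otimes> (m' \<otimes> (y \<oplus> \<one>)) = n \<otimes> (m \<otimes> (y \<oplus> \<one>))" by (simp only: mul_ac)
  ultimately show ?thesis using 2 divides_mult(1) by metis
qed

text \<open>A substitute for the factorial: claiming existence only makes it unnecessary to define a
  recursive function in the model.\<close>

lemma common_multiple: "\<exists>m. m \<noteq> \<zero> \<and> (\<forall>\<delta>. \<delta> \<prec> k \<longrightarrow> \<delta> \<noteq> \<zero> \<longrightarrow> \<delta> \<bar>\<bar> m)"
proof (rule induct[of "\<lambda>k. \<exists>m. m \<noteq> \<zero> \<and> (\<forall>\<delta>. \<delta> \<prec> k \<longrightarrow> \<delta> \<noteq> \<zero> \<longrightarrow> \<delta> \<bar>\<bar> m)" k])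
  show "dpred (\<lambda>\<nu>. \<exists>m. m \<noteq> \<zero> \<and> (\<forall>\<delta>. \<delta> \<prec> \<nu> 0 \<longrightarrow> \<delta> \<noteq> \<zero> \<longrightarrow> \<delta> \<bar>\<bar> m))"
    by (intro dquants dintros dpred_divides)
  show "\<exists>m. m \<noteq> \<zero> \<and> (\<forall>\<delta>. \<delta> \<prec> \<zero> \<longrightarrow> \<delta> \<noteq> \<zero> \<longrightarrow> \<delta> \<bar>\<bar> m)"
    using succ_neq_zero by (metis not_less_zero)
  fix k
  assume "\<exists>m. m \<noteq> \<zero> \<and> (\<forall>\<delta>. \<delta> \<prec> k \<longrightarrow> \<delta> \<noteq> \<zero> \<longrightarrow> \<delta> \<bar>\<bar> m)"
  then obtain m where m: "m \<noteq> \<zero>" "\<And>\<delta>. \<delta> \<prec> k \<Longrightarrow> \<delta> \<noteq> \<zero> \<Longrightarrow> \<delta> \<bar>\<bar> m" by blast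
  show "\<exists>m. m \<noteq> \<zero> \<and> (\<forall>\<delta>. \<delta> \<prec> k \<oplus> \<one> \<longrightarrow> \<delta> \<noteq> \<zero> \<longrightarrow> \<delta> \<bar>\<bar> m)"
  proof (cases "k = \<zero>")
    \<comment> \<open>Multiplying by k = 0 would give 0, so \<open>m\<close> is kept in this
      step.\<close>
    case True
    then show ?thesis using m(1) unfolding True less_succ by (metis not_less_zero)
  next
    case False
    then have "m \<otimes> k \<noteq> \<zero>" using m(1) mul_eq_zero by blast
    moreover have "\<delta> \<bar>\<bar> m \<otimes> k" if "\<delta> \<prec> k \<oplus> \<one>" "\<delta> \<noteq> \<zero>" for \<delta>
      using that m(2) divides_mult divides_refl by (auto simp: less_succ)
    ultimately show ?thesis by blast
  qed
qed

section \<open>Codes of bounded sets\<close>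

definition in_code where
  "in_code x e \<longleftrightarrow> (\<exists>k m n. e = pair k (pair m n) \<and> x \<prec> k \<and> m \<otimes> (x \<oplus> \<one>) \<oplus> \<one> \<bar>\<bar> n)"

abbreviation elts where "elts e \<equiv> {x. in_code x e}"

lemma dpred_in_code: "dterm t \<Longrightarrow> dterm u \<Longrightarrow> dpred (\<lambda>\<nu>. in_code (t \<nu>) (u \<nu>))"
proof (rule dpred_subst2)
  show "dpred (\<lambda>\<nu>. in_code (\<nu> 0) (\<nu> 1))"
    unfolding in_code_def by (intro dquants dintros dpred_divides)
qed

lemmas dcodes = dquants dintros dpred_in_code

lemma elts_sets: "elts e \<in> m_sets M"
  by (rule set_comp) (intro dcodes)

lemma elts_bounded: "\<exists>k. \<forall>x. in_code x e \<longrightarrow> x \<prec> k"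
  unfolding in_code_def by (metis pair_inject)

text \<open>Goedel's beta coding: n is the product of the moduli of the members of \<open>X\<close>,
  built up internally. \<open>m\<close> is a multiple of all differences of numbers below k, so
  \<open>beta_coprime\<close> lets no other modulus divide the product. Within the model, bounded
  and coded thus mean the same.\<close>

lemma code_exists:
  assumes X: "X \<in> m_sets M" "\<And>x. x \<in> X \<Longrightarrow> x \<prec> k"
  shows "\<exists>e. elts e = X"
proof -
  obtain m where m: "m \<noteq> \<zero>" "\<And>\<delta>. \<delta> \<prec> k \<Longrightarrow> \<delta> \<noteq> \<zero> \<Longrightarrow> \<delta> \<bar>\<bar> m" using common_multiple by metis
  let ?d = "\<lambda>y. m \<otimes> (y \<oplus> \<one>) \<oplus> \<one>"
  have cop: "?d y \<bar>\<bar> n" if "?d y \<bar>\<bar> n \<otimes> ?d j" "y \<noteq> j" "y \<prec> k" "j \<prec> k" for y j n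
  proof -
    have "\<exists>\<delta>. \<delta> \<noteq> \<zero> \<and> \<delta> \<prec> k \<and> (j = y \<oplus> \<delta> \<or> y = j \<oplus> \<delta>)"
      using less_linear[of y j] that(2-4) unfolding less_iff_add[of y j] less_iff_add[of j y]
      by (metis le_add2 le_less_trans succ_neq_zero)
    then show ?thesis using beta_coprime[OF that(1)] m(2) by blast
  qed
  have "\<exists>n. \<forall>y. y \<prec> k \<longrightarrow> (?d y \<bar>\<bar> n \<longleftrightarrow> y \<in> X \<and> y \<prec> j)" for j
  proof (rule induct[of "\<lambda>j. \<exists>n. \<forall>y. y \<prec> k \<longrightarrow> (?d y \<bar>\<bar> n \<longleftrightarrow> y \<in> X \<and> y \<prec> j)" j])
    show "dpred (\<lambda>\<nu>. \<exists>n. \<forall>y. y \<prec> k \<longrightarrow> (?d y \<bar>\<bar> n \<longleftrightarrow> y \<in> X \<and> y \<prec> \<nu> 0))"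
      by (intro dquants dintros dpred_divides X)
    \<comment> \<open>Stage 0 takes n = 1; since \<open>m\<close> is nonzero, no modulus equals
      1.\<close>
    have "\<not> ?d y \<bar>\<bar> \<one>" for y
    proof
      assume "?d y \<bar>\<bar> \<one>"
      then obtain u where u: "\<one> = ?d y \<otimes> u" unfolding divides_def by blast
      then have "u \<noteq> \<zero>" using succ_neq_zero[of \<zero>] by auto
      then obtain v where "u = v \<oplus> \<one>" using zero_or_succ by blast
      then have "\<zero> \<oplus> \<one> = (?d y \<otimes> v \<oplus> m \<otimes> (y \<oplus> \<one>)) \<oplus> \<one>" using u
        by (simp add: mul_succ add_assoc)
      then have "m \<otimes> (y \<oplus> \<one>) = \<zero>" using succ_inject add_eq_zero by metis
      then show False using m(1) mul_eq_zero[of m "y \<oplus> \<one>"] by simp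
    qed
    then show "\<exists>n. \<forall>y. y \<prec> k \<longrightarrow> (?d y \<bar>\<bar> n \<longleftrightarrow> y \<in> X \<and> y \<prec> \<zero>)"
      using not_less_zero by blast
    fix j
    assume "\<exists>n. \<forall>y. y \<prec> k \<longrightarrow> (?d y \<bar>\<bar> n \<longleftrightarrow> y \<in> X \<and> y \<prec> j)"
    then obtain n where n: "\<And>y. y \<prec> k \<Longrightarrow> ?d y \<bar>\<bar> n \<longleftrightarrow> y \<in> X \<and> y \<prec> j" by blast
    show "\<exists>n. \<forall>y. y \<prec> k \<longrightarrow> (?d y \<bar>\<bar> n \<longleftrightarrow> y \<in> X \<and> y \<prec> j \<oplus> \<one>)"
    proof (cases "j \<in> X")
      case True
      have "?d y \<bar>\<bar> n \<otimes> ?d j \<longleftrightarrow> y \<in> X \<and> y \<prec> j \<oplus> \<one>" if "y \<prec> k" for y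
      proof (cases "y = j")
        case True
        then show ?thesis using \<open>j \<in> X\<close> divides_mult(2)[OF divides_refl] by (simp add: less_succ)
      next
        case False
        have "?d y \<bar>\<bar> n \<otimes> ?d j \<longleftrightarrow> ?d y \<bar>\<bar> n"
          using cop[OF _ False that X(2)[OF True]] divides_mult(1) by blast
        then show ?thesis using n[OF that] False by (simp add: less_succ)
      qed
      then show ?thesis by blast
    next
      case False
      then have "?d y \<bar>\<bar> n \<longleftrightarrow> y \<in> X \<and> y \<prec> j \<oplus> \<one>" if "y \<prec> k" for y
        using n[OF that] by (auto simp: less_succ)
      then show ?thesis by blast
    qed
  qed
  then obtain n where "\<And>y. y \<prec> k \<Longrightarrow> ?d y \<bar>\<bar> n \<longleftrightarrow> y \<in> X \<and> y \<prec> k" by blast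
  then have "in_code x (pair k (pair m n)) \<longleftrightarrow> x \<in> X" for x
    using X(2) by (auto simp: in_code_def)
  then show ?thesis by blast
qed

lemma code_union: "\<exists>e. elts e = elts e1 \<union> elts e2"
proof -
  obtain k1 k2 where "\<forall>x. in_code x e1 \<longrightarrow> x \<prec> k1" "\<forall>x. in_code x e2 \<longrightarrow> x \<prec> k2"
    using elts_bounded by metis
  then have "x \<prec> k1 \<oplus> k2" if "x \<in> elts e1 \<union> elts e2" for x
    using that less_le_trans le_add1 le_add2 by (metis Un_iff mem_Collect_eq)
  moreover have "{x. in_code x e1 \<or> in_code x e2} \<in> m_sets M"
    by (rule set_comp) (intro dcodes)
  ultimately show ?thesis by (intro code_exists) (auto simp: Collect_disj_eq)
qed

lemma code_singleton: "\<exists>e. elts e = {a}"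
proof (rule code_exists)
  have "{x. x = a} \<in> m_sets M" by (rule set_comp) (intro dcodes)
  then show "{a} \<in> m_sets M" by simp
  show "x \<prec> a \<oplus> \<one>" if "x \<in> {a}" for x using that by (simp add: less_succ)
qed

lemma code_empty: "\<exists>e. elts e = {}"
proof (rule code_exists)
  have "{x. False} \<in> m_sets M" by (rule set_comp) (intro dcodes)
  then show "{} \<in> m_sets M" by simp
qed simp

lemma code_insert: "\<exists>e'. elts e' = insert a (elts e)"
  using code_singleton[of a] code_union[of _ e] by (metis insert_is_Un)


section \<open>Closures\<close>

definition closed where
  "closed D A \<longleftrightarrow> (\<forall>f n. pair f n \<in> D \<longrightarrow> elts f \<subseteq> A \<longrightarrow> n \<in> A)"

text \<open>A derivation is a coded set of pairs (stage, element); its elements lie in \<open>Z\<close> or follow by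
  \<open>D\<close> from elements of earlier stages.\<close>

definition derivation where
  "derivation D Z e \<longleftrightarrow> (\<forall>i a. in_code (pair i a) e \<longrightarrow>
    a \<in> Z \<or> (\<exists>f. pair f a \<in> D \<and> (\<forall>b. in_code b f \<longrightarrow> (\<exists>j. j \<prec> i \<and> in_code (pair j b) e))))"

text \<open>Existence of a coded derivation is an arithmetical condition, also when \<open>Z\<close>
  is given by a code.\<close>

definition cl where
  "cl D Z = {a. \<exists>e. derivation D Z e \<and> (\<exists>i. in_code (pair i a) e)}"

text \<open>The justification of an entry uses \<open>e\<close> only positively, so two derivations
  can be united without renumbering stages.\<close>

lemma derivation_union:
  assumes "derivation D Z e1" "derivation D Z e2" "elts e = elts e1 \<union> elts e2"
  shows "derivation D Z e"
proof -
  have "in_code x e \<longleftrightarrow> in_code x e1 \<or> in_code x e2" for x using assms(3) by auto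
  then show ?thesis using assms(1,2) unfolding derivation_def by meson
qed

lemma subset_cl: "Z \<subseteq> cl D Z"
proof
  fix a
  assume "a \<in> Z"
  obtain e where "elts e = {pair \<zero> a}" using code_singleton by blast
  then have e: "in_code x e \<longleftrightarrow> x = pair \<zero> a" for x by auto
  then have "derivation D Z e" using \<open>a \<in> Z\<close> by (auto simp: derivation_def)
  then show "a \<in> cl D Z" using e unfolding cl_def by blast
qed

context
  fixes D
  assumes D: "D \<in> m_sets M"
begin

text \<open>Elements of \<open>f\<close> are derived separately and may be nonstandardly many, so
  their derivations are merged by internal induction on a bound for \<open>f\<close>.\<close>

lemma cover:
  assumes Z: "Z \<in> m_sets M" and f: "elts f \<subseteq> cl D Z"
  shows "\<exists>e. derivation D Z e \<and> (\<forall>b. in_code b f \<longrightarrow> (\<exists>j. in_code (pair j b) e))"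
proof -
  have "\<exists>e. derivation D Z e \<and> (\<forall>b. b \<prec> k \<longrightarrow> in_code b f \<longrightarrow> (\<exists>j. in_code (pair j b) e))" for k
  proof (rule induct[of "\<lambda>k. \<exists>e. derivation D Z e \<and>
      (\<forall>b. b \<prec> k \<longrightarrow> in_code b f \<longrightarrow> (\<exists>j. in_code (pair j b) e))" k])
    show "dpred (\<lambda>\<nu>. \<exists>e. derivation D Z e \<and>
        (\<forall>b. b \<prec> \<nu> 0 \<longrightarrow> in_code b f \<longrightarrow> (\<exists>j. in_code (pair j b) e)))"
      unfolding derivation_def by (intro dcodes D Z)
    obtain e where "elts e = {}" using code_empty by blast
    then show "\<exists>e. derivation D Z e \<and> (\<forall>b. b \<prec> \<zero> \<longrightarrow> in_code b f \<longrightarrow> (\<exists>j. in_code (pair j b) e))"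
      by (intro exI[of _ e]) (auto simp: derivation_def)
    fix k
    assume "\<exists>e. derivation D Z e \<and> (\<forall>b. b \<prec> k \<longrightarrow> in_code b f \<longrightarrow> (\<exists>j. in_code (pair j b) e))"
    then obtain e where e: "derivation D Z e"
      "\<And>b. b \<prec> k \<Longrightarrow> in_code b f \<Longrightarrow> \<exists>j. in_code (pair j b) e" by blast
    show "\<exists>e. derivation D Z e \<and> (\<forall>b. b \<prec> k \<oplus> \<one> \<longrightarrow> in_code b f \<longrightarrow> (\<exists>j. in_code (pair j b) e))"
    proof (cases "in_code k f")
      case True
      then obtain e' i where e': "derivation D Z e'" "in_code (pair i k) e'"
        using f unfolding cl_def by blast
      obtain e'' where e'': "elts e'' = elts e \<union> elts e'" using code_union by blast
      then have "in_code x e'' \<longleftrightarrow> in_code x e \<or> in_code x e'" for x by auto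
      moreover have "derivation D Z e''" using derivation_union e(1) e'(1) e'' by blast
      ultimately show ?thesis using e(2) e'(2) unfolding less_succ by metis
    next
      case False
      then show ?thesis using e unfolding less_succ by metis
    qed
  qed
  moreover obtain k where "\<forall>x. in_code x f \<longrightarrow> x \<prec> k" using elts_bounded by blast
  ultimately show ?thesis by metis
qed

lemma cl_closed:
  assumes "Z \<in> m_sets M"
  shows "closed D (cl D Z)"
  unfolding closed_def
proof (intro allI impI)
  fix f a
  assume fa: "pair f a \<in> D" "elts f \<subseteq> cl D Z"
  obtain e where e: "derivation D Z e" "\<And>b. in_code b f \<Longrightarrow> \<exists>j. in_code (pair j b) e"
    using cover[OF assms fa(2)] by blast
  \<comment> \<open>A bound for the entries also bounds their stages, because j \<le>
    \<open>pair j b\<close>; so k is a stage later than all of them.\<close>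
  obtain k where k: "\<And>x. in_code x e \<Longrightarrow> x \<prec> k" using elts_bounded by blast
  obtain e' where "elts e' = insert (pair k a) (elts e)" using code_insert by blast
  then have e': "in_code x e' \<longleftrightarrow> x = pair k a \<or> in_code x e" for x by auto
  have "\<exists>j. j \<prec> k \<and> in_code (pair j b) e'" if b: "in_code b f" for b
  proof -
    obtain j where j: "in_code (pair j b) e" using e(2)[OF b] by blast
    then have "j \<prec> k" using k le_pair1 le_less_trans by blast
    then show ?thesis using j e' by blast
  qed
  then have "derivation D Z e'"
    using e(1) fa(1) unfolding derivation_def e' by (metis pair_inject)
  then show "a \<in> cl D Z" using e' unfolding cl_def by blast
qed

text \<open>By induction on a strict upper bound for the stages. Since \<open>Y\<close> is a set of
  the model, the induction can be carried out inside it.\<close>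

lemma cl_least:
  assumes Y: "Y \<in> m_sets M" "Z \<subseteq> Y" "closed D Y"
  shows "cl D Z \<subseteq> Y"
proof
  fix a
  assume "a \<in> cl D Z"
  then obtain e i where e: "derivation D Z e" "in_code (pair i a) e" unfolding cl_def by blast
  have "\<forall>j a. j \<prec> i \<longrightarrow> in_code (pair j a) e \<longrightarrow> a \<in> Y" for i
  proof (rule induct[of "\<lambda>i. \<forall>j a. j \<prec> i \<longrightarrow> in_code (pair j a) e \<longrightarrow> a \<in> Y" i])
    show "dpred (\<lambda>\<nu>. \<forall>j a. j \<prec> \<nu> 0 \<longrightarrow> in_code (pair j a) e \<longrightarrow> a \<in> Y)"
      by (intro dcodes Y)
    fix i
    assume IH: "\<forall>j a. j \<prec> i \<longrightarrow> in_code (pair j a) e \<longrightarrow> a \<in> Y"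
    show "\<forall>j a. j \<prec> i \<oplus> \<one> \<longrightarrow> in_code (pair j a) e \<longrightarrow> a \<in> Y"
    proof (intro allI impI)
      fix j a
      assume j: "j \<prec> i \<oplus> \<one>" "in_code (pair j a) e"
      have "a \<in> Z \<or> (\<exists>f. pair f a \<in> D \<and> (\<forall>b. in_code b f \<longrightarrow> (\<exists>j'. j' \<prec> j \<and> in_code (pair j' b) e)))"
        using e(1) j(2) unfolding derivation_def by blast
      then show "a \<in> Y"
      proof
        assume "\<exists>f. pair f a \<in> D \<and> (\<forall>b. in_code b f \<longrightarrow> (\<exists>j'. j' \<prec> j \<and> in_code (pair j' b) e))"
        then obtain f where f: "pair f a \<in> D"
          "\<And>b. in_code b f \<Longrightarrow> \<exists>j'. j' \<prec> j \<and> in_code (pair j' b) e" by blast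
        have "elts f \<subseteq> Y"
          using f(2) IH j(1) le_iff_less_succ less_le_trans by blast
        then show ?thesis using f(1) Y(3) unfolding closed_def by blast
      qed (use Y(2) in blast)
    qed
  qed simp
  then show "a \<in> Y" using e(2) less_succ by blast
qed

lemma cl_sets: "Z \<in> m_sets M \<Longrightarrow> cl D Z \<in> m_sets M"
  unfolding cl_def derivation_def by (rule set_comp) (intro dcodes D)

text \<open>The coded part of the generators varies with the assignment and is no fixed set
  parameter, so the definition of \<open>cl\<close> is unfolded down to
  \<open>in_code\<close>.\<close>

lemma dpred_cl_code:
  assumes "B \<in> m_sets M" "dterm t" "dterm u"
  shows "dpred (\<lambda>\<nu>. t \<nu> \<in> cl D (B \<union> elts (u \<nu>)))"
proof (rule dpred_subst2[OF _ assms(2,3)])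
  show "dpred (\<lambda>\<nu>. \<nu> 0 \<in> cl D (B \<union> elts (\<nu> 1)))"
    unfolding cl_def derivation_def Un_iff mem_Collect_eq by (intro dcodes D assms)
qed

text \<open>Only elements of \<open>X\<close> occurring in the derivation matter, and a \<le>
  \<open>pair i a\<close> puts these below every bound for its entries.\<close>

lemma derivation_finite:
  assumes "derivation D (B \<union> X) e" "\<And>x. in_code x e \<Longrightarrow> x \<prec> k"
  shows "derivation D (B \<union> {x \<in> X. x \<prec> k}) e"
  using assms le_pair2 le_less_trans unfolding derivation_def by blast

end

end


section \<open>Maximal closed extensions\<close>

text \<open>\<open>\<Phi>\<close> may have any complexity: \<open>W\<close> is the one instance of
  comprehension asked for it, and \<open>finite_character\<close> lets codes decide it on every set
  of the model.\<close>

locale closure_extension = ca_model M for M :: "'a model" +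
  fixes D A B :: "'a set" and \<Phi> :: "'a set \<Rightarrow> bool"
  assumes D: "D \<in> m_sets M" and A: "A \<in> m_sets M" and B: "B \<in> m_sets M"
    and W: "{e. \<Phi> (elts e)} \<in> m_sets M"
    and finite_character: "X \<in> m_sets M \<Longrightarrow> \<Phi> X \<longleftrightarrow>
      (\<forall>Y\<in>m_sets M. (\<exists>k. \<forall>y. y \<in> Y \<longrightarrow> y \<prec> k) \<and> Y \<subseteq> X \<longrightarrow> \<Phi> Y)"
    and B_closed: "closed D B" and B_subset: "B \<subseteq> A" and B_\<Phi>: "\<Phi> B"
begin

text \<open>The bounded sets of the model are exactly the coded ones, so the quantifier over finite
  subsets becomes a number quantifier.\<close>

lemma \<Phi>_codes: "X \<in> m_sets M \<Longrightarrow> \<Phi> X \<longleftrightarrow> (\<forall>e. elts e \<subseteq> X \<longrightarrow> \<Phi> (elts e))"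
  using finite_character elts_sets elts_bounded code_exists by (metis mem_Collect_eq)

text \<open>The second conjunct spells out \<open>\<Phi>\<close> of the closure through codes, which
  makes the condition definable from \<open>W\<close> and reduces compactness to coded
  subsets.\<close>

definition \<Psi> where
  "\<Psi> X \<longleftrightarrow> cl D (B \<union> X) \<subseteq> A \<and> (\<forall>e. elts e \<subseteq> cl D (B \<union> X) \<longrightarrow> \<Phi> (elts e))"

lemma Un_sets: "X \<in> m_sets M \<Longrightarrow> B \<union> X \<in> m_sets M"
proof -
  assume "X \<in> m_sets M"
  then have "{x. x \<in> B \<or> x \<in> X} \<in> m_sets M" by (intro set_comp dcodes B)
  then show ?thesis by (simp add: Un_def)
qed

lemma \<Psi>_empty: "\<Psi> {}"
proof -
  have "cl D (B \<union> {}) \<subseteq> B" by (rule cl_least[OF D B]) (use B_closed in auto)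
  then show ?thesis using B_subset B_\<Phi> \<Phi>_codes[OF B] unfolding \<Psi>_def by blast
qed

text \<open>Each element of the closure, and each coded set of such elements, has a single
  derivation using only members of \<open>X\<close> below some k. Any failure of
  \<open>\<Psi>\<close> would thus show at an initial segment.\<close>

lemma \<Psi>_compact:
  assumes X: "X \<in> m_sets M" and fin: "\<And>k. \<Psi> {x \<in> X. x \<prec> k}"
  shows "\<Psi> X"
proof -
  have bounded: "\<exists>k. \<forall>a i. in_code (pair i a) e \<longrightarrow> a \<in> cl D (B \<union> {x \<in> X. x \<prec> k})"
    if e: "derivation D (B \<union> X) e" for e
  proof -
    obtain k where "\<forall>x. in_code x e \<longrightarrow> x \<prec> k" using elts_bounded by blast
    then have "derivation D (B \<union> {x \<in> X. x \<prec> k}) e" using derivation_finite[OF D e] by blast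
    then show ?thesis unfolding cl_def by blast
  qed
  have "a \<in> A" if "a \<in> cl D (B \<union> X)" for a
    using that bounded fin unfolding cl_def[of D "B \<union> X"] \<Psi>_def by blast
  moreover have "\<Phi> (elts f)" if f: "elts f \<subseteq> cl D (B \<union> X)" for f
  proof -
    obtain e where e: "derivation D (B \<union> X) e" "\<And>b. in_code b f \<Longrightarrow> \<exists>j. in_code (pair j b) e"
      using cover[OF D Un_sets[OF X] f] by blast
    obtain k where "\<forall>a i. in_code (pair i a) e \<longrightarrow> a \<in> cl D (B \<union> {x \<in> X. x \<prec> k})"
      using bounded[OF e(1)] by blast
    then have "elts f \<subseteq> cl D (B \<union> {x \<in> X. x \<prec> k})" using e(2) by blast
    then show ?thesis using fin[of k] unfolding \<Psi>_def by blast
  qed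
  ultimately show ?thesis unfolding \<Psi>_def by blast
qed

section \<open>The greedy set of generators\<close>

definition V where "V = {c. \<Psi> (elts c)}"

text \<open>\<open>V\<close> does for \<open>\<Psi>\<close> what \<open>W\<close> does for
  \<open>\<Phi>\<close>: from here on \<open>\<Psi>\<close> of a bounded set is a definable
  condition.\<close>

lemma V_sets: "V \<in> m_sets M"
proof -
  have "V = {c. (\<forall>a. a \<in> cl D (B \<union> elts c) \<longrightarrow> a \<in> A) \<and>
      (\<forall>e. (\<forall>b. in_code b e \<longrightarrow> b \<in> cl D (B \<union> elts c)) \<longrightarrow> e \<in> {e. \<Phi> (elts e)})}"
    unfolding V_def \<Psi>_def by blast
  also have "\<dots> \<in> m_sets M"
    by (rule set_comp) (intro dquants dpred_cl_code dcodes D B A W)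
  finally show ?thesis .
qed

text \<open>Membership is decided greedily: \<open>a\<close> enters unless this violates \<open>\<Psi>\<close>, given the earlier
  decisions.  A code \<open>c\<close> records the decisions below \<open>k\<close>.\<close>

definition decides where
  "decides k c \<longleftrightarrow> (\<forall>a. (in_code a c \<longrightarrow> a \<prec> k) \<and>
    (a \<prec> k \<longrightarrow> (in_code a c \<longleftrightarrow> \<Psi> (insert a {x. in_code x c \<and> x \<prec> a}))))"

text \<open>Trades \<open>\<Psi>\<close> of a bounded set for a quantifier over codes in
  \<open>V\<close>, a form to which the introduction rules for \<open>dpred\<close> apply.\<close>

lemma \<Psi>_code:
  assumes "X \<in> m_sets M" "\<And>x. x \<in> X \<Longrightarrow> x \<prec> k"
  shows "\<Psi> X \<longleftrightarrow> (\<exists>d. d \<in> V \<and> (\<forall>x. in_code x d \<longleftrightarrow> x \<in> X))"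
proof
  obtain d where d: "elts d = X" using code_exists[OF assms] by blast
  assume "\<Psi> X"
  then have "d \<in> V" using d by (simp add: V_def)
  moreover have "\<forall>x. in_code x d \<longleftrightarrow> x \<in> X" using d by blast
  ultimately show "\<exists>d. d \<in> V \<and> (\<forall>x. in_code x d \<longleftrightarrow> x \<in> X)" by blast
next
  assume "\<exists>d. d \<in> V \<and> (\<forall>x. in_code x d \<longleftrightarrow> x \<in> X)"
  then show "\<Psi> X" by (auto simp: V_def)
qed

lemma \<Psi>_insert_code:
  "\<Psi> (insert a {x. in_code x c \<and> x \<prec> a}) \<longleftrightarrow>
    (\<exists>d. d \<in> V \<and> (\<forall>x. in_code x d \<longleftrightarrow> x = a \<or> (in_code x c \<and> x \<prec> a)))"
proof -
  let ?X = "{x. x = a \<or> in_code x c \<and> x \<prec> a}"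
  have "?X \<in> m_sets M" by (rule set_comp) (intro dcodes)
  then have "\<Psi> ?X \<longleftrightarrow> (\<exists>d. d \<in> V \<and> (\<forall>x. in_code x d \<longleftrightarrow> x \<in> ?X))"
    by (rule \<Psi>_code[of ?X "a \<oplus> \<one>"]) (auto simp: less_succ)
  moreover have "?X = insert a {x. in_code x c \<and> x \<prec> a}" by blast
  ultimately show ?thesis by (simp only: mem_Collect_eq insert_iff)
qed

lemma dpred_decides:
  assumes "dterm t" "dterm u"
  shows "dpred (\<lambda>\<nu>. decides (t \<nu>) (u \<nu>))"
proof (rule dpred_subst2[OF _ assms])
  show "dpred (\<lambda>\<nu>. decides (\<nu> 0) (\<nu> 1))"
    unfolding decides_def \<Psi>_insert_code by (intro dcodes V_sets)
qed

lemma decides_exists: "\<exists>c. decides k c"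
proof (rule induct[of "\<lambda>k. \<exists>c. decides k c" k])
  show "dpred (\<lambda>\<nu>. \<exists>c. decides (\<nu> 0) c)" by (intro dquants dpred_decides dcodes)
  obtain c where "elts c = {}" using code_empty by blast
  then show "\<exists>c. decides \<zero> c" by (auto simp: decides_def)
  fix k
  assume "\<exists>c. decides k c"
  then obtain c where c: "decides k c" by blast
  obtain d where "elts d = insert k (elts c)" using code_insert by blast
  then have d: "in_code x d \<longleftrightarrow> x = k \<or> in_code x c" for x by auto
  \<comment> \<open>All entries of \<open>c\<close> lie below k. So the test for k concerns all of
    \<open>elts c\<close>, and the absence of k from \<open>c\<close> can count as a
    rejection.\<close>
  have below: "in_code x c \<Longrightarrow> x \<prec> k" for x using c unfolding decides_def by blast
  then have notk: "\<not> in_code k c" using less_irrefl by blast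
  have ck: "{x. in_code x c \<and> x \<prec> k} = elts c" using below by blast
  have dk: "{x. in_code x d \<and> x \<prec> k} = elts c" using below d by auto
  \<comment> \<open>Inserting k leaves untouched every test made for a smaller number.\<close>
  have restrict: "{x. in_code x d \<and> x \<prec> a} = {x. in_code x c \<and> x \<prec> a}" if "a \<prec> k" for a
    using that less_not_sym d by auto
  show "\<exists>c. decides (k \<oplus> \<one>) c"
  proof (cases "\<Psi> (insert k (elts c))")
    case True
    have "decides (k \<oplus> \<one>) d"
      unfolding decides_def
    proof (intro allI conjI impI)
      show "a \<prec> k \<oplus> \<one>" if "in_code a d" for a
        using that d below less_succ by blast
      show "in_code a d \<longleftrightarrow> \<Psi> (insert a {x. in_code x d \<and> x \<prec> a})" if "a \<prec> k \<oplus> \<one>" for a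
      proof (cases "a = k")
        case a: True
        then show ?thesis using True d dk by simp
      next
        case False
        then have "a \<prec> k" using that less_succ by blast
        then show ?thesis using c d False restrict unfolding decides_def by simp
      qed
    qed
    then show ?thesis by blast
  next
    case False
    have "decides (k \<oplus> \<one>) c"
      unfolding decides_def
    proof (intro allI conjI impI)
      show "a \<prec> k \<oplus> \<one>" if "in_code a c" for a
        using that below less_succ by blast
      show "in_code a c \<longleftrightarrow> \<Psi> (insert a {x. in_code x c \<and> x \<prec> a})" if "a \<prec> k \<oplus> \<one>" for a
      proof (cases "a = k")
        case a: True
        then show ?thesis using False notk ck by simp
      next
        case a: False
        then have "a \<prec> k" using that less_succ by blast
        then show ?thesis using c unfolding decides_def by simp
      qed
    qed
    then show ?thesis by blast
  qed
qed

text \<open>The decision on a number reads only smaller decisions, so agreement spreads upwards by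
  induction. Hence \<open>G\<close> does not depend on the choice of records.\<close>

lemma decides_unique:
  assumes c: "decides k c" and c': "decides k' c'"
  shows "a \<prec> k \<Longrightarrow> a \<prec> k' \<Longrightarrow> in_code a c \<longleftrightarrow> in_code a c'"
proof -
  have "\<forall>a. a \<prec> i \<and> a \<prec> k \<and> a \<prec> k' \<longrightarrow> (in_code a c \<longleftrightarrow> in_code a c')" for i
  proof (rule induct[of "\<lambda>i. \<forall>a. a \<prec> i \<and> a \<prec> k \<and> a \<prec> k' \<longrightarrow> (in_code a c \<longleftrightarrow> in_code a c')" i])
    show "dpred (\<lambda>\<nu>. \<forall>a. a \<prec> \<nu> 0 \<and> a \<prec> k \<and> a \<prec> k' \<longrightarrow> (in_code a c \<longleftrightarrow> in_code a c'))"
      by (intro dcodes)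
    fix i
    assume IH: "\<forall>a. a \<prec> i \<and> a \<prec> k \<and> a \<prec> k' \<longrightarrow> (in_code a c \<longleftrightarrow> in_code a c')"
    have "in_code i c \<longleftrightarrow> in_code i c'" if i: "i \<prec> k" "i \<prec> k'"
    proof -
      have "{x. in_code x c \<and> x \<prec> i} = {x. in_code x c' \<and> x \<prec> i}"
        using IH less_trans i by blast
      then show ?thesis using c c' i unfolding decides_def by metis
    qed
    then show "\<forall>a. a \<prec> i \<oplus> \<one> \<and> a \<prec> k \<and> a \<prec> k' \<longrightarrow> (in_code a c \<longleftrightarrow> in_code a c')"
      using IH unfolding less_succ by blast
  qed simp
  then show "a \<prec> k \<Longrightarrow> a \<prec> k' \<Longrightarrow> in_code a c \<longleftrightarrow> in_code a c'"
    using zero_less_succ less_succ by blast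
qed

text \<open>A record settles the numbers strictly below its length, so length
  \<open>a \<oplus> \<one>\<close> is the first to settle a.\<close>

definition G where "G = {a. \<exists>c. decides (a \<oplus> \<one>) c \<and> in_code a c}"

lemma G_sets: "G \<in> m_sets M"
  unfolding G_def by (rule set_comp) (intro dquants dpred_decides dcodes)

lemma G_decides:
  assumes "decides k c" "a \<prec> k"
  shows "a \<in> G \<longleftrightarrow> in_code a c"
proof -
  have "a \<prec> a \<oplus> \<one>" by (simp add: less_succ)
  then show ?thesis
    using decides_unique[OF assms(1) _ assms(2)] decides_exists[of "a \<oplus> \<one>"]
    unfolding G_def by blast
qed

lemma G_rec: "a \<in> G \<longleftrightarrow> \<Psi> (insert a {x \<in> G. x \<prec> a})"
proof -
  obtain c where c: "decides (a \<oplus> \<one>) c" using decides_exists by blast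
  have "{x \<in> G. x \<prec> a} = {x. in_code x c \<and> x \<prec> a}"
    using G_decides[OF c] less_succ by blast
  then show ?thesis using c G_decides[OF c, of a] unfolding decides_def less_succ by simp
qed

text \<open>By compactness initial segments suffice. A step either leaves the segment unchanged or
  adds a number whose admission, by \<open>G_rec\<close>, was tested against exactly this
  segment.\<close>

lemma \<Psi>_G: "\<Psi> G"
proof (rule \<Psi>_compact[OF G_sets])
  fix k
  have code: "\<Psi> {x \<in> G. x \<prec> k} \<longleftrightarrow> (\<exists>c. c \<in> V \<and> (\<forall>x. in_code x c \<longleftrightarrow> x \<in> G \<and> x \<prec> k))" for k
  proof -
    have "{x. x \<in> G \<and> x \<prec> k} \<in> m_sets M" by (rule set_comp) (intro dcodes G_sets)
    then have "\<Psi> {x \<in> G. x \<prec> k} \<longleftrightarrow> (\<exists>c. c \<in> V \<and> (\<forall>x. in_code x c \<longleftrightarrow> x \<in> {x \<in> G. x \<prec> k}))"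
      by (rule \<Psi>_code[of _ k]) simp
    then show ?thesis by (simp only: mem_Collect_eq)
  qed
  show "\<Psi> {x \<in> G. x \<prec> k}"
  proof (rule induct[of "\<lambda>k. \<Psi> {x \<in> G. x \<prec> k}" k])
    show "dpred (\<lambda>\<nu>. \<Psi> {x \<in> G. x \<prec> \<nu> 0})" unfolding code by (intro dcodes V_sets G_sets)
    show "\<Psi> {x \<in> G. x \<prec> \<zero>}" using \<Psi>_empty by simp
    show "\<Psi> {x \<in> G. x \<prec> k \<oplus> \<one>}" if "\<Psi> {x \<in> G. x \<prec> k}" for k
    proof (cases "k \<in> G")
      case True
      then have "{x \<in> G. x \<prec> k \<oplus> \<one>} = insert k {x \<in> G. x \<prec> k}" by (auto simp: less_succ)
      then show ?thesis using G_rec[of k] True by metis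
    next
      case False
      then have "{x \<in> G. x \<prec> k \<oplus> \<one>} = {x \<in> G. x \<prec> k}" by (auto simp: less_succ)
      then show ?thesis using that by simp
    qed
  qed
qed

theorem maximal_extension:
  "\<exists>X\<in>m_sets M. B \<subseteq> X \<and> closed D X \<and> X \<subseteq> A \<and> \<Phi> X \<and>
    (\<forall>Y\<in>m_sets M. closed D Y \<and> Y \<subseteq> A \<and> \<Phi> Y \<and> X \<subseteq> Y \<longrightarrow> Y \<subseteq> X)"
proof (intro bexI conjI ballI impI)
  let ?X = "cl D (B \<union> G)"
  note BG = Un_sets[OF G_sets]
  show X: "?X \<in> m_sets M" by (rule cl_sets[OF D BG])
  show "B \<subseteq> ?X" using subset_cl by blast
  show "closed D ?X" by (rule cl_closed[OF D BG])
  show "?X \<subseteq> A" using \<Psi>_G unfolding \<Psi>_def by blast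
  show "\<Phi> ?X" using \<Psi>_G \<Phi>_codes[OF X] unfolding \<Psi>_def by blast
  fix Y
  assume Y: "Y \<in> m_sets M" and *: "closed D Y \<and> Y \<subseteq> A \<and> \<Phi> Y \<and> ?X \<subseteq> Y"
  show "Y \<subseteq> ?X"
  proof
    fix a
    assume a: "a \<in> Y"
    have "B \<union> G \<subseteq> Y" using * subset_cl by blast
    then have "cl D (B \<union> insert a {x \<in> G. x \<prec> a}) \<subseteq> Y"
      using a * by (intro cl_least[OF D Y]) auto
    then have "\<Psi> (insert a {x \<in> G. x \<prec> a})"
      using * \<Phi>_codes[OF Y] unfolding \<Psi>_def by blast
    then show "a \<in> ?X" using G_rec subset_cl by blast
  qed
qed

end


section \<open>Classes of formulas\<close>

text \<open>The index \<open>X\<close> is not removed: its slot stays in the assignment with an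
  irrelevant value. Only atomic formulas change, and they become arithmetical rather than
  bounded.\<close>

primrec code_sub :: "fm \<Rightarrow> nat \<Rightarrow> nat \<Rightarrow> fm" where
  "code_sub (Eq t u) e X = Eq t u"
| "code_sub (Less t u) e X = Less t u"
| "code_sub (Mem t Y) e X = (if Y = X then in_code_fm t (Var e) else Mem t Y)"
| "code_sub Fls e X = Fls"
| "code_sub (Imp p q) e X = Imp (code_sub p e X) (code_sub q e X)"
| "code_sub (AllN p) e X = AllN (code_sub p (Suc e) X)"
| "code_sub (AllS p) e X = AllS (code_sub p e (Suc X))"

lemma arithmetical_bounded: "bounded_fm p \<Longrightarrow> arithmetical p"
  by (induction rule: bounded_fm.induct) auto

lemma arithmetical_fsub [simp]: "arithmetical (fsub s r p) = arithmetical p"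
  by (induction p arbitrary: s r) auto

lemma arithmetical_code_sub: "arithmetical p \<Longrightarrow> arithmetical (code_sub p e X)"
  by (induction p arbitrary: e X) (auto simp: in_code_fm_def dvd_fm_def)

lemma arithmetical_class:
  "(p \<in> Sigma_fm 0 n \<longrightarrow> arithmetical p) \<and> (p \<in> Pi_fm 0 n \<longrightarrow> arithmetical p)"
  by (induction n arbitrary: p) (auto simp: arithmetical_bounded)

lemma class_fsub:
  assumes "i \<in> {0, 1}"
  shows "(p \<in> Sigma_fm i n \<longrightarrow> fsub s r p \<in> Sigma_fm i n) \<and> (p \<in> Pi_fm i n \<longrightarrow> fsub s r p \<in> Pi_fm i n)"
  using assms by (induction n arbitrary: p s r) (auto simp: bounded_fm_fsub)

lemma class_code_sub:
  "(p \<in> Sigma_fm 1 n \<longrightarrow> code_sub p e X \<in> Sigma_fm 1 n) \<and> (p \<in> Pi_fm 1 n \<longrightarrow> code_sub p e X \<in> Pi_fm 1 n)"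
  by (induction n arbitrary: p e X) (auto simp: arithmetical_code_sub)

lemma sat_shiftN: "sat M \<nu> \<sigma> (shiftN p) \<longleftrightarrow> sat M (\<lambda>i. \<nu> (Suc i)) \<sigma> p"
  by (simp add: shiftN_def sat_fsub)

text \<open>Dummy quantifiers raise a matrix to any level. For set quantifiers this preserves truth
  because the model has at least one set.\<close>

lemma class_pad:
  assumes "i \<in> {0, 1}" "m_sets M \<noteq> {}" "p \<in> Sigma_fm i 0"
  shows "(\<exists>q\<in>Sigma_fm i n. \<forall>\<nu> \<sigma>. sat M \<nu> \<sigma> q \<longleftrightarrow> sat M \<nu> \<sigma> p) \<and>
    (\<exists>q\<in>Pi_fm i n. \<forall>\<nu> \<sigma>. sat M \<nu> \<sigma> q \<longleftrightarrow> sat M \<nu> \<sigma> p)"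
proof (induction n)
  case 0
  have "Pi_fm i 0 = Sigma_fm i 0" by simp
  then show ?case using assms(3) by blast
next
  case (Suc n)
  then obtain q q' where q: "q \<in> Sigma_fm i n" "\<And>\<nu> \<sigma>. sat M \<nu> \<sigma> q \<longleftrightarrow> sat M \<nu> \<sigma> p"
    and q': "q' \<in> Pi_fm i n" "\<And>\<nu> \<sigma>. sat M \<nu> \<sigma> q' \<longleftrightarrow> sat M \<nu> \<sigma> p" by metis
  obtain X where X: "X \<in> m_sets M" using assms(2) by blast
  show ?case
  proof (cases "i = 0")
    case True
    have "AllN (shiftN q) \<in> Pi_fm i (Suc n)" "ExN (shiftN q') \<in> Sigma_fm i (Suc n)"
      using q(1) q'(1) class_fsub[OF assms(1)] True by (auto simp: shiftN_def)
    moreover have "sat M \<nu> \<sigma> (AllN (shiftN q)) \<longleftrightarrow> sat M \<nu> \<sigma> p"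
      "sat M \<nu> \<sigma> (ExN (shiftN q')) \<longleftrightarrow> sat M \<nu> \<sigma> p" for \<nu> \<sigma>
      using q(2) q'(2) by (simp_all add: sat_shiftN)
    ultimately show ?thesis by metis
  next
    case False
    have "AllS (shiftS q) \<in> Pi_fm i (Suc n)" "ExS (shiftS q') \<in> Sigma_fm i (Suc n)"
      using q(1) q'(1) class_fsub[OF assms(1)] False by (auto simp: shiftS_def)
    moreover have "sat M \<nu> \<sigma> (AllS (shiftS q)) \<longleftrightarrow> sat M \<nu> \<sigma> p"
      "sat M \<nu> \<sigma> (ExS (shiftS q')) \<longleftrightarrow> sat M \<nu> \<sigma> p" for \<nu> \<sigma>
      using q(2) q'(2) X by (auto simp: sat_shiftS)
    ultimately show ?thesis by metis
  qed
qed

section \<open>Comprehension available in models of the theories\<close>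

lemma comprehension_sat:
  assumes "sat M \<nu> \<sigma> (comprehension_ax p)"
  shows "{x. sat M (case_nat x \<nu>) \<sigma> p} \<in> m_sets M"
proof -
  obtain X where "X \<in> m_sets M" "\<And>x. x \<in> X \<longleftrightarrow> sat M (case_nat x \<nu>) \<sigma> p"
    using assms by (auto simp: comprehension_ax_def sat_shiftS)
  moreover from this(2) have "X = {x. sat M (case_nat x \<nu>) \<sigma> p}" by blast
  ultimately show ?thesis by simp
qed

lemma valid_comprehension:
  "valid M (comprehension_ax p) \<Longrightarrow> range \<sigma> \<subseteq> m_sets M \<Longrightarrow>
    {x. sat M (case_nat x \<nu>) \<sigma> p} \<in> m_sets M"
  using comprehension_sat unfolding valid_def by blast

lemma valid_delta_comprehension:
  assumes "valid M (delta_comprehension_ax p q)" "range \<sigma> \<subseteq> m_sets M"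
    "\<And>x. sat M (case_nat x \<nu>) \<sigma> p \<longleftrightarrow> sat M (case_nat x \<nu>) \<sigma> q"
  shows "{x. sat M (case_nat x \<nu>) \<sigma> p} \<in> m_sets M"
proof (rule comprehension_sat)
  have "sat M \<nu> \<sigma> (delta_comprehension_ax p q)" using assms(1,2) unfolding valid_def by blast
  then show "sat M \<nu> \<sigma> (comprehension_ax p)"
    using assms(3) by (simp add: delta_comprehension_ax_def)
qed

lemma CA0_class_comprehension:
  assumes T: "\<And>\<chi>. \<chi> \<in> CA0 C \<Longrightarrow> valid M \<chi>" and \<sigma>: "range \<sigma> \<subseteq> m_sets M"
  shows "C = SigmaC i n \<Longrightarrow> p \<in> Sigma_fm i n \<Longrightarrow> {x. sat M (case_nat x \<nu>) \<sigma> p} \<in> m_sets M"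
    and "C = PiC i n \<Longrightarrow> p \<in> Pi_fm i n \<Longrightarrow> {x. sat M (case_nat x \<nu>) \<sigma> p} \<in> m_sets M"
    and "C = Delta1C n \<Longrightarrow> p \<in> Sigma_fm 1 n \<Longrightarrow> q \<in> Pi_fm 1 n \<Longrightarrow>
      (\<And>x. sat M (case_nat x \<nu>) \<sigma> p \<longleftrightarrow> sat M (case_nat x \<nu>) \<sigma> q) \<Longrightarrow>
      {x. sat M (case_nat x \<nu>) \<sigma> p} \<in> m_sets M"
proof -
  assume "C = SigmaC i n" "p \<in> Sigma_fm i n"
  then have "ucl (comprehension_ax p) \<in> CA0 C" by (auto simp: CA0_def)
  then show "{x. sat M (case_nat x \<nu>) \<sigma> p} \<in> m_sets M"
    using valid_comprehension[OF _ \<sigma>] T by fastforce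
next
  assume "C = PiC i n" "p \<in> Pi_fm i n"
  then have "ucl (comprehension_ax p) \<in> CA0 C" by (auto simp: CA0_def)
  then show "{x. sat M (case_nat x \<nu>) \<sigma> p} \<in> m_sets M"
    using valid_comprehension[OF _ \<sigma>] T by fastforce
next
  assume *: "C = Delta1C n" "p \<in> Sigma_fm 1 n" "q \<in> Pi_fm 1 n"
    "\<And>x. sat M (case_nat x \<nu>) \<sigma> p \<longleftrightarrow> sat M (case_nat x \<nu>) \<sigma> q"
  have "ucl (delta_comprehension_ax p q) \<in> CA0 C"
    unfolding CA0_def *(1) CA.simps using *(2,3) by blast
  then show "{x. sat M (case_nat x \<nu>) \<sigma> p} \<in> m_sets M"
    using valid_delta_comprehension[OF _ \<sigma> *(4)] T by fastforce
qed

text \<open>Each class at level at least 1 gives this much, though by different routes: the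
  existential arithmetical classes need a complement, the analytical ones treat
  \<open>AllN p\<close> as part of the matrix.\<close>

lemma CA0_all_comprehension:
  assumes T: "\<And>\<chi>. \<chi> \<in> CA0 C \<Longrightarrow> valid M \<chi>" and ne: "m_sets M \<noteq> {}"
    and C: "i \<in> {0, 1}" "n \<ge> 1" "C = PiC i n \<or> C = SigmaC i n \<or> C = Delta1C n"
    and p: "bounded_fm p" and \<sigma>: "range \<sigma> \<subseteq> m_sets M"
  shows "{x. sat M (case_nat x \<nu>) \<sigma> (AllN p)} \<in> m_sets M"
proof -
  note comp = CA0_class_comprehension[OF T, of C]
  have arith: "AllN p \<in> Sigma_fm 1 0" using p by (simp add: arithmetical_bounded)
  obtain m where n: "n = Suc m" using C(2) by (cases n) auto
  consider "C = SigmaC 0 n" | "C = PiC 0 n" | "C = SigmaC 1 n" | "C = PiC 1 n" | "C = Delta1C n"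
    using C by auto
  then show ?thesis
  proof cases
    case 1
    have "Neg p \<in> Sigma_fm 0 0" using p by (simp add: bounded_fm.intros)
    then obtain q where q: "q \<in> Pi_fm 0 m" "\<And>\<nu> \<sigma>. sat M \<nu> \<sigma> q \<longleftrightarrow> sat M \<nu> \<sigma> (Neg p)"
      using class_pad[of 0 M "Neg p" m] ne by auto
    define X where "X = {x. sat M (case_nat x \<nu>) \<sigma> (ExN q)}"
    have X: "X \<in> m_sets M"
      unfolding X_def by (rule comp(1)[OF _ \<sigma> 1]) (use q(1) n in auto)
    \<comment> \<open>\<open>X\<close> collects the numbers with a counterexample to
      \<open>p\<close>. A second comprehension, with \<open>X\<close> as set parameter and padded to
      level n, yields the complement.\<close>
    have "Neg (Mem (Var 0) 0) \<in> Sigma_fm 0 0" by (simp add: bounded_fm.intros)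
    then obtain r where r: "r \<in> Sigma_fm 0 n"
      "\<And>\<nu> \<sigma>. sat M \<nu> \<sigma> r \<longleftrightarrow> sat M \<nu> \<sigma> (Neg (Mem (Var 0) 0))"
      using class_pad[of 0 M "Neg (Mem (Var 0) 0)" n] ne by auto
    have "{x. sat M (case_nat x \<nu>) (\<lambda>_. X) r} \<in> m_sets M"
      by (rule comp(1)[OF _ _ 1 r(1)]) (use X in auto)
    moreover have "{x. sat M (case_nat x \<nu>) (\<lambda>_. X) r} = {x. sat M (case_nat x \<nu>) \<sigma> (AllN p)}"
      by (auto simp: r(2) X_def q(2))
    ultimately show ?thesis by simp
  next
    case 2
    \<comment> \<open>The leading quantifier stays, and only the matrix is padded, to level n -
      1.\<close>
    obtain q where q: "q \<in> Sigma_fm 0 m" "\<And>\<nu> \<sigma>. sat M \<nu> \<sigma> q \<longleftrightarrow> sat M \<nu> \<sigma> p"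
      using class_pad[of 0 M p m] ne p by auto
    have "{x. sat M (case_nat x \<nu>) \<sigma> (AllN q)} \<in> m_sets M"
      by (rule comp(2)[OF _ \<sigma> 2]) (use q(1) n in auto)
    then show ?thesis by (simp add: q(2))
  next
    case 3
    obtain q where q: "q \<in> Sigma_fm 1 n" "\<And>\<nu> \<sigma>. sat M \<nu> \<sigma> q \<longleftrightarrow> sat M \<nu> \<sigma> (AllN p)"
      using class_pad[OF _ ne arith, of n] by auto
    show ?thesis using comp(1)[OF _ \<sigma> 3 q(1)] by (simp only: q(2))
  next
    case 4
    obtain q where q: "q \<in> Pi_fm 1 n" "\<And>\<nu> \<sigma>. sat M \<nu> \<sigma> q \<longleftrightarrow> sat M \<nu> \<sigma> (AllN p)"
      using class_pad[OF _ ne arith, of n] by auto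
    show ?thesis using comp(2)[OF _ \<sigma> 4 q(1)] by (simp only: q(2))
  next
    case 5
    \<comment> \<open>Both formulas are paddings of \<open>AllN p\<close>, so the equivalence
      demanded by the comprehension axiom holds by construction.\<close>
    obtain q r where q: "q \<in> Sigma_fm 1 n" "\<And>\<nu> \<sigma>. sat M \<nu> \<sigma> q \<longleftrightarrow> sat M \<nu> \<sigma> (AllN p)"
      and r: "r \<in> Pi_fm 1 n" "\<And>\<nu> \<sigma>. sat M \<nu> \<sigma> r \<longleftrightarrow> sat M \<nu> \<sigma> (AllN p)"
      using class_pad[OF _ ne arith, of n] by auto
    show ?thesis using comp(3)[OF _ \<sigma> 5 q(1) r(1)] by (simp only: q(2) r(2))
  qed
qed

lemma CA0_ca_model:
  assumes T: "\<And>\<chi>. \<chi> \<in> CA0 C \<Longrightarrow> valid M \<chi>" and "m_sets M \<noteq> {}"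
    and "i \<in> {0, 1}" "n \<ge> 1" "C = PiC i n \<or> C = SigmaC i n \<or> C = Delta1C n"
  shows "ca_model M"
proof
  show "m_sets M \<noteq> {}" by fact
  show "valid M p" if "p \<in> basic_axioms" for p
    using T[of "ucl p"] that by (simp add: CA0_def RCA0_def)
  show "valid M (induction_ax p)" if "p \<in> Sigma_fm 0 1" for p
  proof -
    have "ucl (induction_ax p) \<in> CA0 C" using that unfolding CA0_def RCA0_def by blast
    then show ?thesis using T by fastforce
  qed
  show "{x. sat M (case_nat x \<nu>) \<sigma> (AllN p)} \<in> m_sets M"
    if "bounded_fm p" "range \<sigma> \<subseteq> m_sets M" for p \<sigma> \<nu>
    using CA0_all_comprehension[OF T assms(2-5) that] by blast
qed

context ca_model
begin

lemma arithmetical_comprehension: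
  assumes "arithmetical p" "range \<sigma> \<subseteq> m_sets M"
  shows "{x. sat M (case_nat x \<nu>) \<sigma> p} \<in> m_sets M"
proof (rule set_comp)
  let ?s = "\<lambda>i \<nu>'. case i of 0 \<Rightarrow> \<nu>' 0 | Suc i \<Rightarrow> \<nu> i"
  have "dterm (?s i)" for i by (cases i) (auto intro: dterm.intros)
  then show "dpred (\<lambda>\<nu>'. sat M (case_nat (\<nu>' 0) \<nu>) \<sigma> p)"
    using dpred_subst[OF sat_arithmetical[OF assms], of ?s] by simp
qed

section \<open>What the formulas of the scheme mean in a model\<close>

lemma eval_pair_tm: "eval M \<nu> (pair_tm t u) = pair (eval M \<nu> t) (eval M \<nu> u)"
  by (simp add: pair_tm_def pair_def)

lemma sat_in_code_fm: "sat M \<nu> \<sigma> (in_code_fm t u) \<longleftrightarrow> in_code (eval M \<nu> t) (eval M \<nu> u)"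
  by (simp add: in_code_fm_def dvd_fm_def in_code_def divides_def eval_lift eval_pair_tm
      numeral_eq_Suc) blast

lemma sat_code_sub: "sat M \<nu> \<sigma> (code_sub p e X) \<longleftrightarrow> sat M \<nu> (\<sigma>(X := elts (\<nu> e))) p"
proof (induction p arbitrary: \<nu> \<sigma> e X)
  case (AllS p)
  have "(case_nat Y \<sigma>)(Suc X := elts (\<nu> e)) = case_nat Y (\<sigma>(X := elts (\<nu> e)))" for Y
    by (rule ext) (simp split: nat.split)
  then show ?case by (simp add: AllS del: fun_upd_apply)
qed (simp_all add: sat_in_code_fm)

text \<open>\<open>shiftN\<close> frees number variable 0 for the code; \<open>Z\<close> merely
  fills the slot of the replaced set variable.\<close>

lemma sat_code_sub_shiftN:
  "sat M (case_nat e \<nu>) (case_nat Z \<sigma>) (code_sub (shiftN p) 0 0) \<longleftrightarrow>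
    sat M \<nu> (case_nat (elts e) \<sigma>) p"
proof -
  have "(case_nat Z \<sigma>)(0 := elts e) = case_nat (elts e) \<sigma>"
    by (rule ext) (simp split: nat.split)
  then show ?thesis by (simp add: sat_code_sub sat_shiftN)
qed

lemma sat_set_inst:
  "sat M \<nu> \<sigma> (set_inst k Y p) \<longleftrightarrow> sat M \<nu> (case_nat (\<sigma> Y) (\<lambda>i. \<sigma> (i + k))) p"
proof -
  have "(\<lambda>i. \<sigma> (case_nat Y (\<lambda>i. i + k) i)) = case_nat (\<sigma> Y) (\<lambda>i. \<sigma> (i + k))"
    by (rule ext) (simp split: nat.split)
  then show ?thesis by (simp add: set_inst_def sat_fsub)
qed

lemma sat_closed_fm: "sat M \<nu> \<sigma> (closed_fm X Y) \<longleftrightarrow> closed (\<sigma> X) (\<sigma> Y)"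
  by (auto simp: closed_fm_def closed_def sat_in_code_fm eval_pair_tm numeral_eq_Suc subset_iff)

lemma sat_subset_fm: "sat M \<nu> \<sigma> (subset_fm X Y) \<longleftrightarrow> \<sigma> X \<subseteq> \<sigma> Y"
  by (auto simp: subset_fm_def)

lemma sat_empty_fm: "sat M \<nu> \<sigma> (empty_fm X) \<longleftrightarrow> \<sigma> X = {}"
  by (auto simp: empty_fm_def)

lemma sat_finite_fm: "sat M \<nu> \<sigma> (finite_fm X) \<longleftrightarrow> (\<exists>k. \<forall>x. x \<in> \<sigma> X \<longrightarrow> x \<prec> k)"
  by (simp add: finite_fm_def)

lemma sat_And: "sat M \<nu> \<sigma> (And p q) \<longleftrightarrow> sat M \<nu> \<sigma> p \<and> sat M \<nu> \<sigma> q"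
  by simp

lemma sat_Iff: "sat M \<nu> \<sigma> (Iff p q) \<longleftrightarrow> (sat M \<nu> \<sigma> p \<longleftrightarrow> sat M \<nu> \<sigma> q)"
  by auto

lemma sat_ExS: "sat M \<nu> \<sigma> (ExS p) \<longleftrightarrow> (\<exists>X\<in>m_sets M. sat M \<nu> (case_nat X \<sigma>) p)"
  by simp

lemma sat_ImpI: "(sat M \<nu> \<sigma> p \<Longrightarrow> sat M \<nu> \<sigma> q) \<Longrightarrow> sat M \<nu> \<sigma> (Imp p q)"
  by simp

lemma sat_AllSI: "(\<And>X. X \<in> m_sets M \<Longrightarrow> sat M \<nu> (case_nat X \<sigma>) p) \<Longrightarrow> sat M \<nu> \<sigma> (AllS p)"
  by simp

lemma sat_good_fm:
  "sat M \<nu> \<sigma> (good_fm k D A X p) \<longleftrightarrow>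
    closed (\<sigma> D) (\<sigma> X) \<and> \<sigma> X \<subseteq> \<sigma> A \<and> sat M \<nu> (case_nat (\<sigma> X) (\<lambda>i. \<sigma> (i + k))) p"
  by (simp add: good_fm_def sat_closed_fm sat_subset_fm sat_set_inst)

lemma sat_finite_character_fm:
  "sat M \<nu> \<sigma> (finite_character_fm p) \<longleftrightarrow>
    (\<forall>X\<in>m_sets M. X = {} \<longrightarrow> sat M \<nu> (case_nat X \<sigma>) p) \<and>
    (\<forall>X\<in>m_sets M. sat M \<nu> (case_nat X \<sigma>) p \<longleftrightarrow>
      (\<forall>Y\<in>m_sets M. (\<exists>k. \<forall>y. y \<in> Y \<longrightarrow> y \<prec> k) \<and> Y \<subseteq> X \<longrightarrow> sat M \<nu> (case_nat Y \<sigma>) p))"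
proof -
  have "sat M \<nu> (case_nat X \<sigma>) (AllS (Imp (And (finite_fm 0) (subset_fm 0 1)) (set_inst 2 0 p))) \<longleftrightarrow>
      (\<forall>Y\<in>m_sets M. (\<exists>k. \<forall>y. y \<in> Y \<longrightarrow> y \<prec> k) \<and> Y \<subseteq> X \<longrightarrow> sat M \<nu> (case_nat Y \<sigma>) p)" for X
    unfolding sat.simps(7) sat.simps(5)[of _ _ _ "And _ _"] sat_And sat_finite_fm sat_subset_fm sat_set_inst
    by (simp add: numeral_eq_Suc)
  note eq = this
  show ?thesis
    unfolding finite_character_fm_def sat_And
    unfolding sat.simps(7)
    unfolding sat_Iff eq
    by (simp add: sat_empty_fm sat_set_inst)
qed

text \<open>For fixed parameters an instance of the scheme follows from the existence of one set of
  codes; the semantic theorem \<open>maximal_extension\<close> does the rest.\<close>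

lemma sat_closure_extension_fm:
  assumes \<sigma>: "range \<sigma> \<subseteq> m_sets M"
    and W: "{e. sat M \<nu> (case_nat (elts e) \<sigma>) p} \<in> m_sets M"
  shows "sat M \<nu> \<sigma> (closure_extension_fm p)"
  unfolding closure_extension_fm_def
proof (rule sat_ImpI, rule sat_AllSI, rule sat_AllSI, rule sat_ImpI, rule sat_AllSI, rule sat_ImpI)
  fix D A B
  assume fc: "sat M \<nu> \<sigma> (finite_character_fm p)"
    and sets: "D \<in> m_sets M" "A \<in> m_sets M" "B \<in> m_sets M"
    and "sat M \<nu> (case_nat B (case_nat A (case_nat D \<sigma>))) (good_fm 3 2 1 0 p)"
  then have good: "closed D B" "B \<subseteq> A" "sat M \<nu> (case_nat B \<sigma>) p"
    by (simp_all add: sat_good_fm numeral_eq_Suc)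
  have fc: "\<forall>X\<in>m_sets M. sat M \<nu> (case_nat X \<sigma>) p \<longleftrightarrow>
      (\<forall>Y\<in>m_sets M. (\<exists>k. \<forall>y. y \<in> Y \<longrightarrow> y \<prec> k) \<and> Y \<subseteq> X \<longrightarrow> sat M \<nu> (case_nat Y \<sigma>) p)"
    using fc unfolding sat_finite_character_fm by (rule conjunct2)
  interpret closure_extension M D A B "\<lambda>X. sat M \<nu> (case_nat X \<sigma>) p"
    by unfold_locales (rule sets good W fc[rule_format] | assumption)+
  obtain X where X: "X \<in> m_sets M" "B \<subseteq> X" "closed D X" "X \<subseteq> A" "sat M \<nu> (case_nat X \<sigma>) p"
    and max: "\<And>Y. Y \<in> m_sets M \<Longrightarrow> closed D Y \<Longrightarrow> Y \<subseteq> A \<Longrightarrow> sat M \<nu> (case_nat Y \<sigma>) p \<Longrightarrow>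
      X \<subseteq> Y \<Longrightarrow> Y \<subseteq> X"
    using maximal_extension by metis
  let ?\<sigma> = "case_nat B (case_nat A (case_nat D \<sigma>))"
  have 1: "sat M \<nu> (case_nat X ?\<sigma>) (subset_fm 1 0)"
    using X(2) by (simp add: sat_subset_fm)
  have 2: "sat M \<nu> (case_nat X ?\<sigma>) (good_fm 4 3 2 0 p)"
    using X(3-5) by (simp add: sat_good_fm numeral_eq_Suc)
  have 3: "sat M \<nu> (case_nat X ?\<sigma>)
      (AllS (Imp (And (good_fm 5 4 3 0 p) (subset_fm 1 0)) (subset_fm 0 1)))"
  proof (rule sat_AllSI, rule sat_ImpI)
    fix Y
    assume "Y \<in> m_sets M"
      and "sat M \<nu> (case_nat Y (case_nat X ?\<sigma>)) (And (good_fm 5 4 3 0 p) (subset_fm 1 0))"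
    then have "Y \<subseteq> X"
      unfolding sat_And sat_good_fm sat_subset_fm by (intro max) (simp_all add: numeral_eq_Suc)
    then show "sat M \<nu> (case_nat Y (case_nat X ?\<sigma>)) (subset_fm 0 1)"
      by (simp add: sat_subset_fm)
  qed
  show "sat M \<nu> ?\<sigma> (ExS (And (And (subset_fm 1 0) (good_fm 4 3 2 0 p))
      (AllS (Imp (And (good_fm 5 4 3 0 p) (subset_fm 1 0)) (subset_fm 0 1)))))"
    unfolding sat_ExS sat_And by (rule bexI[OF _ X(1)]) (intro conjI 1 2 3)
qed

end

theorem theorem3p4:
  fixes i n :: nat and C :: fclass
  assumes "i \<in> {0, 1}" and "n \<ge> 1"
    and "C = PiC i n \<or> C = SigmaC i n \<or> C = Delta1C n"
  shows "\<forall>\<chi>\<in>CE C. CA0 C \<turnstile> \<chi>"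
proof
  fix \<chi>
  assume \<chi>: "\<chi> \<in> CE C"
  show "CA0 C \<turnstile> \<chi>"
  proof (rule completeness)
    show "ucl ` basic_axioms \<subseteq> CA0 C" by (auto simp: CA0_def RCA0_def)
    show "closed_form \<psi>" if "\<psi> \<in> CA0 C" for \<psi>
      using that by (cases C) (auto simp: CA0_def RCA0_def closed_form_ucl)
    show "closed_form \<chi>" using \<chi> by (cases C) (auto simp: closed_form_ucl)
    fix M :: "nat model"
    assume ne: "m_sets M \<noteq> {}" and T: "\<And>\<psi>. \<psi> \<in> CA0 C \<Longrightarrow> valid M \<psi>"
    interpret ca_model M by (rule CA0_ca_model[OF T ne assms])
    \<comment> \<open>Any set of the model could fill the replaced slot; \<open>\<sigma> 0\<close>
      is one that is at hand.\<close>
    have codes: "{e. sat M \<nu> (case_nat (elts e) \<sigma>) p} \<in> m_sets M"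
      if "{e. sat M (case_nat e \<nu>) (case_nat (\<sigma> 0) \<sigma>) (code_sub (shiftN p) 0 0)} \<in> m_sets M"
      for \<nu> \<sigma> p
      using that by (simp add: sat_code_sub_shiftN)
    have arith: "{e. sat M \<nu> (case_nat (elts e) \<sigma>) p} \<in> m_sets M"
      if "arithmetical p" "range \<sigma> \<subseteq> m_sets M" for \<nu> \<sigma> p
      using that by (intro codes arithmetical_comprehension) (auto simp: arithmetical_code_sub shiftN_def)
    have shift: "p \<in> Sigma_fm 1 n \<Longrightarrow> code_sub (shiftN p) 0 0 \<in> Sigma_fm 1 n"
      "p \<in> Pi_fm 1 n \<Longrightarrow> code_sub (shiftN p) 0 0 \<in> Pi_fm 1 n" for p
      using class_fsub[of 1 p n] class_code_sub unfolding shiftN_def by blast+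
    note comp = CA0_class_comprehension[OF T, of C]
    show "valid M \<chi>"
    proof (cases C)
      case (SigmaC j k)
      with assms(3) have C: "C = SigmaC i n" by auto
      with \<chi> obtain p where p: "\<chi> = ucl (closure_extension_fm p)" "p \<in> Sigma_fm i n" by auto
      have W: "{e. sat M \<nu> (case_nat (elts e) \<sigma>) p} \<in> m_sets M" if \<sigma>: "range \<sigma> \<subseteq> m_sets M" for \<nu> \<sigma>
      proof (cases "i = 0")
        case True
        \<comment> \<open>For number quantifiers \<open>code_sub\<close> may leave the class, but
          \<phi> is arithmetical and arithmetical comprehension applies.\<close>
        then show ?thesis using p(2) arithmetical_class arith[OF _ \<sigma>] by blast
      next
        case False
        then have "i = 1" using assms(1) by simp
        then show ?thesis
          using p(2) C \<sigma> shift by (intro codes comp(1)) auto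
      qed
      show ?thesis
        unfolding p(1) valid_ucl unfolding valid_def by (intro allI impI sat_closure_extension_fm W)
    next
      case (PiC j k)
      with assms(3) have C: "C = PiC i n" by auto
      with \<chi> obtain p where p: "\<chi> = ucl (closure_extension_fm p)" "p \<in> Pi_fm i n" by auto
      have W: "{e. sat M \<nu> (case_nat (elts e) \<sigma>) p} \<in> m_sets M" if \<sigma>: "range \<sigma> \<subseteq> m_sets M" for \<nu> \<sigma>
      proof (cases "i = 0")
        case True
        then show ?thesis using p(2) arithmetical_class arith[OF _ \<sigma>] by blast
      next
        case False
        then have "i = 1" using assms(1) by simp
        then show ?thesis
          using p(2) C \<sigma> shift by (intro codes comp(2)) auto
      qed
      show ?thesis
        unfolding p(1) valid_ucl unfolding valid_def by (intro allI impI sat_closure_extension_fm W)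
    next
      case (Delta1C k)
      with assms(3) have C: "C = Delta1C n" by auto
      with \<chi> obtain p q where p: "\<chi> = ucl (Imp (AllS (Iff p q)) (closure_extension_fm p))"
        "p \<in> Sigma_fm 1 n" "q \<in> Pi_fm 1 n" by auto
      have W: "{e. sat M \<nu> (case_nat (elts e) \<sigma>) p} \<in> m_sets M"
        if \<sigma>: "range \<sigma> \<subseteq> m_sets M" and pq: "sat M \<nu> \<sigma> (AllS (Iff p q))" for \<nu> \<sigma>
      \<comment> \<open>The equivalence of \<open>p\<close> and \<open>q\<close> is known only for
        the present assignment. Each \<open>elts e\<close> is a set of the model, so it carries over
        to the coded versions with the same parameters, which is what comprehension for the class
        requires.\<close>
      proof (rule codes, rule comp(3)[OF _ _ C shift(1)[OF p(2)] shift(2)[OF p(3)]])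
        show "sat M (case_nat e \<nu>) (case_nat (\<sigma> 0) \<sigma>) (code_sub (shiftN p) 0 0) \<longleftrightarrow>
            sat M (case_nat e \<nu>) (case_nat (\<sigma> 0) \<sigma>) (code_sub (shiftN q) 0 0)" for e
          using pq elts_sets[of e] by (auto simp: sat_code_sub_shiftN)
      qed (use \<sigma> in auto)
      show ?thesis
        unfolding p(1) valid_ucl unfolding valid_def sat.simps(5)[of _ _ _ "AllS _"]
        by (intro allI impI sat_closure_extension_fm W)
    qed
  qed
qed

end
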